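(* Let $f\colon X\to Y$ be a continuous map, $x_0\in X$ a base-point, and let $\tilde f_0\colon\tilde X\to\tilde Y$ be a fixed lifting of $f$ with respect to the universal covering maps $p\colon\tilde X\to X$ and $q\colon\tilde Y\to Y$. Then the canonical isomorphism $\pi_1(Y,f(x_0))\xrightarrow{\approx}\mathcal D(Y)$ restricts to an isomorphism $G^f(Y,f(x_0))\xrightarrow{\approx}\mathcal D^{\tilde f_0}(Y)$; that is, it maps the subgroup $G^f(Y,f(x_0))$ isomorphically onto $\mathcal D^{\tilde f_0}(Y)$.
   Context: All spaces are path-connected and have the homotopy type of a CW-complex; $X$ and $Y$ have universal coverings $p\colon\tilde X\to X$, $q\colon\tilde Y\to Y$, to which standard covering space theory applies (lifting criterion, unique lifting, the deck group acts simply transitively on each fibre). $I=[0,1]$. All maps are continuous. $\mathcal D(Y)$ is the group (under composition) of deck transformations of $q\colon\tilde Y\to Y$. A lifting of $f$ is a map $\tilde f\colon\tilde X\to\tilde Y$ with $q\tilde f=fp$. Canonical isomorphism: fix $\tilde x_0\in p^{-1}(x_0)$ and put $\tilde y_0=\tilde f_0(\tilde x_0)\in q^{-1}(f(x_0))$. The class of a loop $\alpha$ at $f(x_0)$ is sent to the unique $h\in\mathcal D(Y)$ such that $h(\tilde y_0)$ is the endpoint of the lift of $\alpha$ to $\tilde Y$ starting at $\tilde y_0$. Generalized Gottlieb group: $G^f(Y,f(x_0))$ is the subgroup of $\pi_1(Y,f(x_0))$ of all elements which can be represented by a map $\alpha\colon\mathbb S^1\to Y$ such that $f\vee\alpha\colon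 X\vee\mathbb S^1\to Y$ extends (up to homotopy) to a map $F\colon X\times\mathbb S^1\to Y$. Equivalently, it consists of the classes of loops $H(x_0,-)$, where $H\colon X\times I\to Y$ is a homotopy with $H(-,0)=H(-,1)=f$. Fibre-preserving homotopy: a map $\tilde H\colon\tilde X\times I\to\tilde Y$ is a fibre-preserving homotopy with respect to $p,q$ if, for all $\tilde x,\tilde x'\in\tilde X$ and $t\in I$, $p(\tilde x)=p(\tilde x')$ implies $q\tilde H(\tilde x,t)=q\tilde H(\tilde x',t)$. $\mathcal D^{\tilde f_0}(Y)$ is the set (it is a subgroup of $\mathcal D(Y)$) of all $h\in\mathcal D(Y)$ for which there is a fibre-preserving homotopy $\tilde H\colon\tilde X\times I\to\tilde Y$ with $\tilde H(-,0)=\tilde f_0$ and $\tilde H(-,1)=h\tilde f_0$. *)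

theory Defs
  imports "HOL-Analysis.Analysis" "HOL-Algebra.Bij"
begin

text \<open>
  A space is a subset of a type of class \<^class>\<open>topological_space\<close> with the subspace topology.
  Maps are functions on the ambient types, of which only the values on the carrier matter.
\<close>

text \<open>
  Whitehead's definition: a Hausdorff space partitioned into open cells \<open>e \<in> C\<close> of dimension
  \<open>d e\<close> with characteristic maps \<open>\<Phi> e\<close>, closure-finite and carrying the weak topology. For
  \<open>n = 0\<close> the ball is the one-point space and the sphere is empty.
\<close>

definition unit_cball :: "nat \<Rightarrow> (nat \<Rightarrow> real) set" where
  "unit_cball n = {x \<in> topspace (Euclidean_space n). (\<Sum>i<n. (x i)\<^sup>2) \<le> 1}"

definition unit_ball :: "nat \<Rightarrow> (nat \<Rightarrow> real) set" where
  "unit_ball n = {x \<in> topspace (Euclidean_space n). (\<Sum>i<n. (x i)\<^sup>2) < 1}"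

definition unit_sphere :: "nat \<Rightarrow> (nat \<Rightarrow> real) set" where
  "unit_sphere n = {x \<in> topspace (Euclidean_space n). (\<Sum>i<n. (x i)\<^sup>2) = 1}"

definition CW_structure ::
  "'a topology \<Rightarrow> 'a set set \<Rightarrow> ('a set \<Rightarrow> nat) \<Rightarrow> ('a set \<Rightarrow> (nat \<Rightarrow> real) \<Rightarrow> 'a) \<Rightarrow> bool" where
  "CW_structure K C d \<Phi> \<longleftrightarrow>
     \<Union>C = topspace K \<and> pairwise disjnt C \<and>
     (\<forall>e\<in>C.
        continuous_map (subtopology (Euclidean_space (d e)) (unit_cball (d e))) K (\<Phi> e) \<and>
        homeomorphic_map (subtopology (Euclidean_space (d e)) (unit_ball (d e)))
          (subtopology K e) (\<Phi> e) \<and>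
        (\<exists>B\<subseteq>C. finite B \<and> (\<forall>b\<in>B. d b < d e) \<and> \<Phi> e ` unit_sphere (d e) \<subseteq> \<Union>B)) \<and>
     (\<forall>A\<subseteq>topspace K. (\<forall>e\<in>C. closedin K (A \<inter> K closure_of e)) \<longrightarrow> closedin K A)"

definition CW_complex :: "'a topology \<Rightarrow> bool" where
  "CW_complex K \<longleftrightarrow> Hausdorff_space K \<and> (\<exists>C d \<Phi>. CW_structure K C d \<Phi>)"

definition loops :: "'a::topological_space set \<Rightarrow> 'a \<Rightarrow> (real \<Rightarrow> 'a) set" where
  "loops Y y = {\<alpha>. path \<alpha> \<and> path_image \<alpha> \<subseteq> Y \<and> pathstart \<alpha> = y \<and> pathfinish \<alpha> = y}"

definition loop_class :: "'a::topological_space set \<Rightarrow> (real \<Rightarrow> 'a) \<Rightarrow> (real \<Rightarrow> 'a) set" where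
  "loop_class Y \<alpha> = {\<beta>. homotopic_paths Y \<alpha> \<beta>}"

definition fundamental_group ::
  "'a::topological_space set \<Rightarrow> 'a \<Rightarrow> (real \<Rightarrow> 'a) set monoid" where
  "fundamental_group Y y =
     \<lparr>carrier = loop_class Y ` loops Y y,
      mult = (\<lambda>a b. \<Union>\<alpha>\<in>a. \<Union>\<beta>\<in>b. loop_class Y (\<alpha> +++ \<beta>)),
      one = loop_class Y (\<lambda>_. y)\<rparr>"

text \<open>Deck transformations are made extensional, as in \<^const>\<open>Bij\<close>, so that they are determined
  by their values on the total space.\<close>

definition deck_transformations ::
  "'e::topological_space set \<Rightarrow> ('e \<Rightarrow> 'b) \<Rightarrow> ('e \<Rightarrow> 'e) set" where
  "deck_transformations E q =
     {h \<in> extensional E. (\<exists>k. homeomorphism E E h k) \<and> (\<forall>e\<in>E. q (h e) = q e)}"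

definition deck_group :: "'e::topological_space set \<Rightarrow> ('e \<Rightarrow> 'b) \<Rightarrow> ('e \<Rightarrow> 'e) monoid" where
  "deck_group E q = (BijGroup E)\<lparr>carrier := deck_transformations E q\<rparr>"

text \<open>
  Spaces are not required to be locally path-connected. The part of standard covering space theory
  that does not hold for every simply connected covering, namely that the deck group acts simply
  transitively on each fibre, is therefore part of the definition.
\<close>

definition universal_covering ::
  "'e::topological_space set \<Rightarrow> ('e \<Rightarrow> 'b::topological_space) \<Rightarrow> 'b set \<Rightarrow> bool" where
  "universal_covering E q B \<longleftrightarrow>
     covering_space E q B \<and> simply_connected E \<and>
     (\<forall>e\<in>E. \<forall>e'\<in>E. q e = q e' \<longrightarrow> (\<exists>!h. h \<in> deck_transformations E q \<and> h e = e'))"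

definition lifting_of ::
  "'d::topological_space set \<Rightarrow> ('d \<Rightarrow> 'x) \<Rightarrow> 'e::topological_space set \<Rightarrow> ('e \<Rightarrow> 'y) \<Rightarrow>
   ('x \<Rightarrow> 'y) \<Rightarrow> ('d \<Rightarrow> 'e) \<Rightarrow> bool" where
  "lifting_of D p E q f g \<longleftrightarrow>
     continuous_on D g \<and> g \<in> D \<rightarrow> E \<and> (\<forall>x\<in>D. q (g x) = f (p x))"

definition path_lift ::
  "'e::topological_space set \<Rightarrow> ('e \<Rightarrow> 'y) \<Rightarrow> 'e \<Rightarrow> (real \<Rightarrow> 'y) \<Rightarrow> (real \<Rightarrow> 'e) \<Rightarrow> bool" where
  "path_lift E q e \<alpha> \<gamma> \<longleftrightarrow>
     path \<gamma> \<and> path_image \<gamma> \<subseteq> E \<and> pathstart \<gamma> = e \<and> (\<forall>t\<in>{0..1}. q (\<gamma> t) = \<alpha> t)"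

definition canonical_map ::
  "'e::topological_space set \<Rightarrow> ('e \<Rightarrow> 'y) \<Rightarrow> 'e \<Rightarrow> (real \<Rightarrow> 'y) set \<Rightarrow> ('e \<Rightarrow> 'e)" where
  "canonical_map E q e c =
     (THE h. h \<in> deck_transformations E q \<and>
             (\<exists>\<alpha>\<in>c. \<exists>\<gamma>. path_lift E q e \<alpha> \<gamma> \<and> h e = pathfinish \<gamma>))"

text \<open>
  The circle is the unit circle in \<^typ>\<open>complex\<close> with base point \<open>1\<close>, and the wedge of \<open>X\<close> with
  the circle is the subspace \<open>X \<times> {1} \<union> {x\<^sub>0} \<times> S\<^sup>1\<close> of the product.
\<close>

definition wedge_circle :: "'x set \<Rightarrow> 'x \<Rightarrow> ('x \<times> complex) set" where
  "wedge_circle X x0 = X \<times> {1} \<union> {x0} \<times> sphere 0 1"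

definition wedge_map :: "('x \<Rightarrow> 'y) \<Rightarrow> (complex \<Rightarrow> 'y) \<Rightarrow> 'x \<times> complex \<Rightarrow> 'y" where
  "wedge_map f a = (\<lambda>(x, z). if z = 1 then f x else a z)"

definition gottlieb_group ::
  "'x::topological_space set \<Rightarrow> 'y::topological_space set \<Rightarrow> ('x \<Rightarrow> 'y) \<Rightarrow> 'x \<Rightarrow>
   (real \<Rightarrow> 'y) set set" where
  "gottlieb_group X Y f x0 =
     {c \<in> carrier (fundamental_group Y (f x0)).
        \<exists>a. continuous_on (sphere 0 1) a \<and> a \<in> sphere 0 1 \<rightarrow> Y \<and> a 1 = f x0 \<and>
            c = loop_class Y (\<lambda>t. a (cis (2 * pi * t))) \<and>
            (\<exists>F. continuous_on (X \<times> sphere 0 1) F \<and> F \<in> X \<times> sphere 0 1 \<rightarrow> Y \<and>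
                 homotopic_with_canon (\<lambda>_. True) (wedge_circle X x0) Y F (wedge_map f a))}"

definition fibre_preserving_homotopy ::
  "'d::topological_space set \<Rightarrow> ('d \<Rightarrow> 'x) \<Rightarrow> 'e::topological_space set \<Rightarrow> ('e \<Rightarrow> 'y) \<Rightarrow>
   ('d \<times> real \<Rightarrow> 'e) \<Rightarrow> bool" where
  "fibre_preserving_homotopy D p E q H \<longleftrightarrow>
     continuous_on (D \<times> {0..1}) H \<and> H \<in> D \<times> {0..1} \<rightarrow> E \<and>
     (\<forall>x\<in>D. \<forall>x'\<in>D. \<forall>t\<in>{0..1}. p x = p x' \<longrightarrow> q (H (x, t)) = q (H (x', t)))"

definition deck_gottlieb ::
  "'d::topological_space set \<Rightarrow> ('d \<Rightarrow> 'x) \<Rightarrow> 'e::topological_space set \<Rightarrow> ('e \<Rightarrow> 'y) \<Rightarrow>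
   ('d \<Rightarrow> 'e) \<Rightarrow> ('e \<Rightarrow> 'e) set" where
  "deck_gottlieb D p E q g =
     {h \<in> deck_transformations E q.
        \<exists>H. fibre_preserving_homotopy D p E q H \<and>
            (\<forall>x\<in>D. H (x, 0) = g x) \<and> (\<forall>x\<in>D. H (x, 1) = h (g x))}"

end

theory Submission
  imports Defs
begin

text \<open>
  A homotopy \<open>H\<close> from \<open>f\<close> to itself is pulled back along \<open>p\<close> and lifted through \<open>q\<close>, starting at the
  given lifting \<open>f\<^sub>0\<close>. The end of the lifted homotopy is again a lifting of \<open>f\<close>, so by unique lifting it is
  \<open>h f\<^sub>0\<close> for the deck transformation \<open>h\<close> that corresponds to the loop \<open>H(x\<^sub>0, -)\<close>. Conversely, a
  fibre-preserving homotopy from \<open>f\<^sub>0\<close> to \<open>h f\<^sub>0\<close> descends along the local sections of \<open>p\<close> to such an \<open>H\<close>.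
\<close>

subsection \<open>Lifting homotopies through a covering\<close>

text \<open>Local path-connectedness is not among the hypotheses, so maps cannot be lifted by a
  criterion on fundamental groups. As \<open>f0\<close> is given, only homotopies have to be lifted,
  and evenly covered neighbourhoods suffice for that; the deck transformations come from the simple
  transitivity in \<open>universal_covering\<close>. The two sides are compared through
  \<open>cyclic_homotopy\<close>, because \<open>gottlieb_group\<close> speaks of the circle and
  allows a free homotopy on the wedge, during which the base point may move. Group laws are checked
  on the deck side, where multiplication is composition, and carried back: the axioms of the
  fundamental group along the canonical bijection, the subgroup property of the Gottlieb group as
  that of a preimage. Most homotopies of paths are read off from maps of a square: two paths along
  its sides with the same ends are homotopic in the square, because it is convex.\<close>

lemma covering_space_sheet:
  assumes "covering_space E p B" "b \<in> B"
  obtains W v where "b \<in> W" "openin (top_of_set B) W" "pairwise disjnt v"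
    "\<And>e. e \<in> E \<Longrightarrow> p e \<in> W \<Longrightarrow> \<exists>u\<in>v. e \<in> u"
    "\<And>u. u \<in> v \<Longrightarrow> openin (top_of_set E) u \<and> (\<exists>k. homeomorphism u W p k)"
proof -
  from assms obtain W where "b \<in> W" "openin (top_of_set B) W"
    "\<exists>v. \<Union>v = E \<inter> p -` W \<and> (\<forall>u \<in> v. openin (top_of_set E) u) \<and>
      pairwise disjnt v \<and> (\<forall>u \<in> v. \<exists>q. homeomorphism u W p q)"
    unfolding covering_space_def by metis
  then show ?thesis
    by (elim exE conjE) (rule that, assumption+, blast+)
qed

lemma openin_preimage:
  assumes "continuous_on T g" "g \<in> T \<rightarrow> E" "openin (top_of_set E) u"
  shows "openin (top_of_set T) {x \<in> T. g x \<in> u}"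
proof -
  have "continuous_map (top_of_set T) (top_of_set E) g"
    using assms by (auto simp: continuous_map_in_subtopology image_subset_iff)
  from openin_continuous_map_preimage[OF this assms(3)] show ?thesis by simp
qed

text \<open>The set where the lifts agree is clopen. Near a point each lift stays in one sheet: if
  the sheets coincide, injectivity of \<open>p\<close> on the sheet forces agreement; if they
  differ, disjointness forces disagreement.\<close>

lemma covering_lift_unique:
  assumes cov: "covering_space E p B"
    and g1: "continuous_on T g1" "g1 \<in> T \<rightarrow> E" and g2: "continuous_on T g2" "g2 \<in> T \<rightarrow> E"
    and eq: "\<And>x. x \<in> T \<Longrightarrow> p (g1 x) = p (g2 x)"
    and T: "connected T" and a: "a \<in> T" "g1 a = g2 a" and x: "x \<in> T"
  shows "g1 x = g2 x"
proof -
  define A where "A = {x \<in> T. g1 x = g2 x}"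
  have nbhd: "\<exists>N. openin (top_of_set T) N \<and> x \<in> N \<and> (N \<subseteq> A \<or> N \<subseteq> T - A)
      \<and> (x \<in> A \<longrightarrow> N \<subseteq> A)" if "x \<in> T" for x
  proof -
    have "p (g1 x) \<in> B"
      using cov g1 \<open>x \<in> T\<close> by (auto simp: covering_space_def)
    then obtain W v where W: "p (g1 x) \<in> W" "pairwise disjnt v"
      "\<And>e. e \<in> E \<Longrightarrow> p e \<in> W \<Longrightarrow> \<exists>u\<in>v. e \<in> u"
      "\<And>u. u \<in> v \<Longrightarrow> openin (top_of_set E) u \<and> (\<exists>k. homeomorphism u W p k)"
      using covering_space_sheet[OF cov] by metis
    have inj: "e = e'" if "u \<in> v" "e \<in> u" "e' \<in> u" "p e = p e'" for e e' u
      using W(4)[OF that(1)] that unfolding homeomorphism_def by metis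
    obtain u1 where u1: "u1 \<in> v" "g1 x \<in> u1"
      using W g1 \<open>x \<in> T\<close> by blast
    have "p (g2 x) \<in> W" using W eq \<open>x \<in> T\<close> by metis
    then obtain u2 where u2: "u2 \<in> v" "g2 x \<in> u2"
      using W g2 \<open>x \<in> T\<close> by blast
    define N where "N = {x \<in> T. g1 x \<in> u1} \<inter> {x \<in> T. g2 x \<in> u2}"
    have "openin (top_of_set T) N"
      unfolding N_def using W(4) u1 u2 g1 g2 by (intro openin_Int openin_preimage) auto
    moreover have "x \<in> N" using \<open>x \<in> T\<close> u1 u2 by (auto simp: N_def)
    moreover have "N \<subseteq> A" if "u1 = u2"
    proof
      fix z assume "z \<in> N"
      then have "z \<in> T" "g1 z \<in> u1" "g2 z \<in> u1" using that by (auto simp: N_def)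
      then show "z \<in> A" using inj[OF u1(1)] eq by (simp add: A_def)
    qed
    moreover have "N \<subseteq> T - A" if "u1 \<noteq> u2"
    proof -
      have "disjnt u1 u2" using W(2) u1 u2 that by (auto simp: pairwise_def)
      then show ?thesis by (auto simp: N_def A_def disjnt_iff)
    qed
    ultimately show ?thesis by blast
  qed
  have "openin (top_of_set T) A"
    by (subst openin_subopen) (use nbhd in \<open>fastforce simp: A_def\<close>)
  moreover have "openin (top_of_set T) (T - A)"
    by (subst openin_subopen) (use nbhd in blast)
  ultimately have "A = {} \<or> A = T"
    using T unfolding connected_clopen closedin_def by (auto simp: A_def)
  then show ?thesis using a x by (auto simp: A_def)
qed

lemma covering_lift_unique_path:
  assumes "covering_space E p B"
    and "continuous_on {0..1::real} g1" "\<And>t. t \<in> {0..1} \<Longrightarrow> g1 t \<in> E"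
    and "continuous_on {0..1} g2" "\<And>t. t \<in> {0..1} \<Longrightarrow> g2 t \<in> E"
    and "\<And>t. t \<in> {0..1} \<Longrightarrow> p (g1 t) = p (g2 t)" "g1 0 = g2 0" "t \<in> {0..1}"
  shows "g1 t = g2 t"
  using covering_lift_unique[OF assms(1), of "{0..1}" g1 g2 0 t] assms by auto

text \<open>The lift grows in time over a neighbourhood of the single point \<open>z0\<close>.
  Compactness of the time interval, in the form of \<open>Bolzano\<close>, leaves finitely many
  steps, so the neighbourhood may shrink at each of them.\<close>

lemma covering_local_homotopy_lift:
  fixes H :: "'z::topological_space \<times> real \<Rightarrow> 'b::topological_space"
  assumes cov: "covering_space E p B"
    and H: "continuous_on (Z \<times> {0..1}) H" "H \<in> Z \<times> {0..1} \<rightarrow> B"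
    and g: "continuous_on Z g" "g \<in> Z \<rightarrow> E" "\<And>z. z \<in> Z \<Longrightarrow> p (g z) = H (z, 0)"
    and z0: "z0 \<in> Z"
  obtains V K where "openin (top_of_set Z) V" "z0 \<in> V"
    "continuous_on (V \<times> {0..1}) K" "K \<in> V \<times> {0..1} \<rightarrow> E"
    "\<And>z. z \<in> V \<Longrightarrow> K (z, 0) = g z" "\<And>w. w \<in> V \<times> {0..1} \<Longrightarrow> p (K w) = H w"
proof -
  define ext where "ext a b U g V K \<longleftrightarrow> openin (top_of_set Z) V \<and> z0 \<in> V \<and> V \<subseteq> U \<and>
      continuous_on (V \<times> {a..b}) K \<and> K \<in> V \<times> {a..b} \<rightarrow> E \<and> (\<forall>z\<in>V. K (z, a) = g z) \<and>
      (\<forall>w\<in>V \<times> {a..b}. p (K w) = H w)" for a b :: real and U V g K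
  define init where "init a U g \<longleftrightarrow> openin (top_of_set Z) U \<and> z0 \<in> U \<and> continuous_on U g \<and>
      g \<in> U \<rightarrow> E \<and> (\<forall>z\<in>U. p (g z) = H (z, a))" for a :: real and U g
  \<comment> \<open>Quantifying over all initial lifts on all neighbourhoods makes the property
    additive: the final values on one interval are admissible initial values on the next.\<close>
  define P where "P a b \<longleftrightarrow> (0 \<le> a \<longrightarrow> b \<le> 1 \<longrightarrow> (\<forall>U g. init a U g \<longrightarrow> (\<exists>V K. ext a b U g V K)))"
    for a b :: real
  have "P 0 1"
  proof (rule Bolzano[of 0 1 P])
    fix a b c assume trans: "P a b" "P b c" "a \<le> b" "b \<le> c"
    show "P a c"
      unfolding P_def
    proof (intro impI allI)
      fix U g assume "0 \<le> a" "c \<le> 1" and ini: "init a U g"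
      have b: "0 \<le> b" "b \<le> 1" using trans \<open>0 \<le> a\<close> \<open>c \<le> 1\<close> by auto
      obtain V1 K1 where "ext a b U g V1 K1"
        using trans(1)[unfolded P_def, rule_format, OF \<open>0 \<le> a\<close> b(2) ini] by blast
      then have 1: "openin (top_of_set Z) V1" "z0 \<in> V1" "V1 \<subseteq> U"
          "continuous_on (V1 \<times> {a..b}) K1" "K1 \<in> V1 \<times> {a..b} \<rightarrow> E" "\<And>z. z \<in> V1 \<Longrightarrow> K1 (z, a) = g z"
          "\<And>z t. z \<in> V1 \<Longrightarrow> t \<in> {a..b} \<Longrightarrow> p (K1 (z,t)) = H (z,t)"
        by (auto simp: ext_def)
      have "continuous_on V1 (\<lambda>z. K1 (z, b))"
        by (rule continuous_on_compose2[OF 1(4)]) (use trans in \<open>auto intro!: continuous_intros\<close>)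
      then have "init b V1 (\<lambda>z. K1 (z, b))"
        using 1 trans unfolding init_def by auto
      from trans(2)[unfolded P_def, rule_format, OF b(1) \<open>c \<le> 1\<close> this]
      obtain V2 K2 where "ext b c V1 (\<lambda>z. K1 (z, b)) V2 K2" by blast
      then have 2: "openin (top_of_set Z) V2" "z0 \<in> V2" "V2 \<subseteq> V1"
          "continuous_on (V2 \<times> {b..c}) K2" "K2 \<in> V2 \<times> {b..c} \<rightarrow> E"
          "\<And>z. z \<in> V2 \<Longrightarrow> K2 (z, b) = K1 (z, b)"
          "\<And>z t. z \<in> V2 \<Longrightarrow> t \<in> {b..c} \<Longrightarrow> p (K2 (z,t)) = H (z,t)"
        by (auto simp: ext_def)
      define K where "K = (\<lambda>w. if snd w \<le> b then K1 w else K2 w)"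
      have "continuous_on (V2 \<times> {a..c}) K"
        unfolding K_def
      proof (rule continuous_on_cases_le)
        show "continuous_on {t \<in> V2 \<times> {a..c}. snd t \<le> b} K1"
          by (rule continuous_on_subset[OF 1(4)]) (use 2 in auto)
        show "continuous_on {t \<in> V2 \<times> {a..c}. b \<le> snd t} K2"
          by (rule continuous_on_subset[OF 2(4)]) auto
      qed (use 2 in \<open>auto intro!: continuous_intros\<close>)
      then have "ext a c U g V2 K"
        using 1 2 trans unfolding ext_def K_def by (auto simp: Pi_iff subset_iff)
      then show "\<exists>V K. ext a c U g V K" by blast
    qed
  next
    fix x :: real assume local: "0 \<le> x" "x \<le> 1"
    have "H (z0, x) \<in> B" using H z0 local by auto
    then obtain W v where W: "H (z0, x) \<in> W" "openin (top_of_set B) W" "pairwise disjnt v"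
      "\<And>e. e \<in> E \<Longrightarrow> p e \<in> W \<Longrightarrow> \<exists>u\<in>v. e \<in> u"
      "\<And>u. u \<in> v \<Longrightarrow> openin (top_of_set E) u \<and> (\<exists>k. homeomorphism u W p k)"
      using covering_space_sheet[OF cov] by metis
    have "openin (top_of_set (Z \<times> {0..1})) {w \<in> Z \<times> {0..1}. H w \<in> W}"
      using openin_preimage[OF H W(2)] .
    then obtain S where S: "open S" "{w \<in> Z \<times> {0..1}. H w \<in> W} = Z \<times> {0..1} \<inter> S"
      unfolding openin_open by blast
    then have "(z0, x) \<in> S" using W z0 local by auto
    then obtain A C where AC: "open A" "open C" "z0 \<in> A" "x \<in> C" "A \<times> C \<subseteq> S"
      using S(1) open_prod_elim by (metis mem_Sigma_iff)
    then obtain d where d: "d > 0" "\<And>t. \<bar>t - x\<bar> < d \<Longrightarrow> t \<in> C"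
      by (metis open_real)
    have HW: "H (z, t) \<in> W" if "z \<in> Z" "z \<in> A" "0 \<le> t" "t \<le> 1" "\<bar>t - x\<bar> < d" for z t
    proof -
      have "(z, t) \<in> Z \<times> {0..1} \<inter> S" using that AC(5) d(2)[of t] by auto
      then show ?thesis using S(2) by blast
    qed
    \<comment> \<open>On a short interval around \<open>x\<close> all values lie in the evenly
      covered \<open>W\<close>, so the inverse \<open>k\<close> of a single sheet lifts
      \<open>H\<close> in one stroke. The sheet is the one that contains
      \<open>g z0\<close>.\<close>
    have "P a b" if ab: "a \<le> x" "x \<le> b" "b - a < d" for a b
      unfolding P_def
    proof (intro impI allI)
      fix U g assume ab': "0 \<le> a" "b \<le> 1" and "init a U g"
      then have U: "openin (top_of_set Z) U" "z0 \<in> U" "continuous_on U g" "g \<in> U \<rightarrow> E"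
          "\<And>z. z \<in> U \<Longrightarrow> p (g z) = H (z, a)"
        by (auto simp: init_def)
      have "U \<subseteq> Z" using U(1) openin_imp_subset by metis
      have "p (g z0) \<in> W" using HW[of z0 a] U ab ab' AC z0 by auto
      then obtain u where u: "u \<in> v" "g z0 \<in> u" using W(4) U by blast
      then obtain k where k: "homeomorphism u W p k" and ou: "openin (top_of_set E) u"
        using W(5) by blast
      \<comment> \<open>Points whose initial value lies in another sheet are discarded, since there
        \<open>k (H (z, a))\<close> would differ from \<open>g z\<close>.\<close>
      define V where "V = {z \<in> U. g z \<in> u} \<inter> (Z \<inter> A)"
      have "openin (top_of_set U) {z \<in> U. g z \<in> u}"
        using openin_preimage U ou by blast
      then have "openin (top_of_set Z) {z \<in> U. g z \<in> u}"
        using U(1) openin_trans by blast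
      moreover have "openin (top_of_set Z) (Z \<inter> A)" using AC(1) by (rule openin_open_Int)
      ultimately have "openin (top_of_set Z) V" unfolding V_def by (rule openin_Int)
      moreover have "z0 \<in> V" using U u AC z0 by (auto simp: V_def)
      moreover have HV: "H w \<in> W" "w \<in> Z \<times> {0..1}" if "w \<in> V \<times> {a..b}" for w
        using that ab ab' HW[of "fst w" "snd w"] by (auto simp: V_def)
      have "continuous_on (V \<times> {a..b}) (\<lambda>w. k (H w))"
      proof (rule continuous_on_compose2[where g = k and f = H])
        show "continuous_on W k" using k by (simp add: homeomorphism_def)
        show "continuous_on (V \<times> {a..b}) H"
          by (rule continuous_on_subset[OF H(1)]) (use HV in blast)
      qed (use HV in blast)
      moreover have "k y \<in> E" "p (k y) = y" if "y \<in> W" for y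
        using k that openin_imp_subset[OF ou] by (auto simp: homeomorphism_def)
      moreover have "k (H (z, a)) = g z" if "z \<in> V" for z
        using that k U(5)[of z] by (auto simp: V_def homeomorphism_def)
      ultimately have "ext a b U g V (\<lambda>w. k (H w))"
        using HV(1) unfolding ext_def Pi_iff by (auto simp: V_def)
      then show "\<exists>V K. ext a b U g V K" by blast
    qed
    then show "\<exists>d>0. \<forall>a b. a \<le> x \<and> x \<le> b \<and> b - a < d \<longrightarrow> P a b" using d(1) by blast
  qed simp
  moreover have "init 0 Z g"
    using g z0 by (auto simp: init_def)
  ultimately obtain V K where "ext 0 1 Z g V K" unfolding P_def
    by auto blast
  then show ?thesis using that[of V K] by (auto simp: ext_def)
qed

text \<open>Local lifts agree where both are defined, because over each fixed point they lift the
  same path from the same start. Uniqueness is applied along the time interval only, so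
  \<open>Z\<close> may be disconnected.\<close>

theorem covering_homotopy_lift:
  fixes H :: "'z::topological_space \<times> real \<Rightarrow> 'b::topological_space"
  assumes cov: "covering_space E p B"
    and H: "continuous_on (Z \<times> {0..1}) H" "H \<in> Z \<times> {0..1} \<rightarrow> B"
    and g: "continuous_on Z g" "g \<in> Z \<rightarrow> E" "\<And>z. z \<in> Z \<Longrightarrow> p (g z) = H (z, 0)"
  obtains K where "continuous_on (Z \<times> {0..1}) K" "K \<in> Z \<times> {0..1} \<rightarrow> E"
    "\<And>z. z \<in> Z \<Longrightarrow> K (z, 0) = g z" "\<And>w. w \<in> Z \<times> {0..1} \<Longrightarrow> p (K w) = H w"
proof -
  define loc where "loc i V K \<longleftrightarrow> openin (top_of_set Z) V \<and> i \<in> V \<and>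
      continuous_on (V \<times> {0..1}) K \<and> K \<in> V \<times> {0..1} \<rightarrow> E \<and>
      (\<forall>z\<in>V. K (z, 0) = g z) \<and> (\<forall>w\<in>V \<times> {0..1}. p (K w) = H w)" for i V K
  have "\<exists>V K. loc i V K" if "i \<in> Z" for i
    using covering_local_homotopy_lift[OF cov H g that] unfolding loc_def by metis
  then obtain V K where "\<And>i. i \<in> Z \<Longrightarrow> loc i (V i) (K i)"
    by metis
  then have VK: "\<And>i. i \<in> Z \<Longrightarrow> openin (top_of_set Z) (V i)"
      "\<And>i. i \<in> Z \<Longrightarrow> i \<in> V i" "\<And>i. i \<in> Z \<Longrightarrow> continuous_on (V i \<times> {0..1}) (K i)"
      "\<And>i. i \<in> Z \<Longrightarrow> K i \<in> V i \<times> {0..1} \<rightarrow> E"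
      "\<And>i z. i \<in> Z \<Longrightarrow> z \<in> V i \<Longrightarrow> K i (z, 0) = g z"
      "\<And>i w. i \<in> Z \<Longrightarrow> w \<in> V i \<times> {0..1} \<Longrightarrow> p (K i w) = H w"
    unfolding loc_def by blast+
  have agree: "K i (z, t) = K j (z, t)" if "i \<in> Z" "j \<in> Z" "z \<in> V i" "z \<in> V j" "t \<in> {0..1}" for i j z t
  proof (rule covering_lift_unique_path[OF cov, where t = t])
    show "continuous_on {0..1} (\<lambda>t. K i (z, t))" "continuous_on {0..1} (\<lambda>t. K j (z, t))"
      by (rule continuous_on_compose2[OF VK(3)[of i]] continuous_on_compose2[OF VK(3)[of j]],
          use that in \<open>auto intro!: continuous_intros\<close>)+
    show "K i (z, t) \<in> E" "K j (z, t) \<in> E" if "t \<in> {0..1}" for t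
      using VK(4) \<open>i \<in> Z\<close> \<open>j \<in> Z\<close> \<open>z \<in> V i\<close> \<open>z \<in> V j\<close> that by blast+
  qed (use VK(5,6) that in auto)
  \<comment> \<open>Each point uses the local lift that was built around it; by \<open>agree\<close>
    every other choice gives the same value.\<close>
  define L where "L w = K (fst w) w" for w
  have "continuous_map (top_of_set (Z \<times> {0..1})) euclidean L"
  proof (rule pasting_lemma[where I = Z and T = "\<lambda>i. V i \<times> {0..1}" and f = K])
    fix i assume i: "i \<in> Z"
    show "openin (top_of_set (Z \<times> {0..1::real})) (V i \<times> {0..1})"
      using VK(1)[OF i] by (simp add: openin_Times)
    have "V i \<subseteq> Z" using VK(1)[OF i] openin_imp_subset by metis
    then show "continuous_map (subtopology (top_of_set (Z \<times> {0..1})) (V i \<times> {0..1})) euclidean (K i)"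
      using VK(3)[OF i] by (simp add: subtopology_subtopology Int_absorb1 Times_Int_Times)
  next
    fix i j w assume "i \<in> Z" "j \<in> Z"
      "w \<in> topspace (top_of_set (Z \<times> {0..1::real})) \<inter> V i \<times> {0..1} \<inter> V j \<times> {0..1}"
    then show "K i w = K j w" using agree[of i j "fst w" "snd w"] by auto
  next
    fix w assume "w \<in> topspace (top_of_set (Z \<times> {0..1::real}))"
    then show "\<exists>j. j \<in> Z \<and> w \<in> V j \<times> {0..1} \<and> L w = K j w"
      using VK(2) by (intro exI[of _ "fst w"]) (auto simp: L_def)
  qed
  moreover have "L \<in> Z \<times> {0..1} \<rightarrow> E" using VK(2,4) by (fastforce simp: L_def)
  ultimately show ?thesis
    using that[of L] VK(2,5,6) by (auto simp: L_def)
qed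

subsection \<open>Monodromy\<close>

text \<open>A path is a homotopy of maps from a one-point space, here \<open>{0}\<close>.\<close>

lemma path_lift_exists:
  assumes cov: "covering_space E q B" and "e \<in> E" and \<alpha>: "path \<alpha>" "path_image \<alpha> \<subseteq> B" "pathstart \<alpha> = q e"
  obtains \<gamma> where "path_lift E q e \<alpha> \<gamma>"
proof -
  have "continuous_on ({0::real} \<times> {0..1}) (\<lambda>w. \<alpha> (snd w))"
    by (rule continuous_on_compose2[of "{0..1}" \<alpha>])
      (use \<alpha> in \<open>auto simp: path_def intro!: continuous_intros\<close>)
  moreover have "(\<lambda>w. \<alpha> (snd w)) \<in> {0::real} \<times> {0..1} \<rightarrow> B"
    using \<alpha> by (auto simp: path_image_def)
  ultimately obtain K where K: "continuous_on ({0::real} \<times> {0..1::real}) K" "K \<in> {0::real} \<times> {0..1} \<rightarrow> E"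
    "\<And>z. z \<in> {0::real} \<Longrightarrow> K (z, 0) = e" "\<And>w. w \<in> {0::real} \<times> {0..1} \<Longrightarrow> q (K w) = \<alpha> (snd w)"
    using covering_homotopy_lift[OF cov, of "{0::real}" "\<lambda>w. \<alpha> (snd w)" "\<lambda>_. e"] \<alpha> \<open>e \<in> E\<close>
    by (auto simp: pathstart_def)
  have "continuous_on {0..1} (\<lambda>t. K (0, t))"
    by (rule continuous_on_compose2[OF K(1)]) (auto intro!: continuous_intros)
  then have "path_lift E q e \<alpha> (\<lambda>t. K (0, t))"
    using K(2-4) by (auto simp: path_lift_def path_def path_image_def pathstart_def)
  then show ?thesis by (rule that)
qed

lemma path_liftD:
  assumes "path_lift E q e \<alpha> \<gamma>"
  shows "continuous_on {0..1} \<gamma>" "t \<in> {0..1} \<Longrightarrow> \<gamma> t \<in> E" "\<gamma> 0 = e" "t \<in> {0..1} \<Longrightarrow> q (\<gamma> t) = \<alpha> t"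
  using assms by (auto simp: path_lift_def path_def path_image_def pathstart_def)

lemma path_liftI:
  assumes "continuous_on {0..1} \<gamma>" "\<And>t. t \<in> {0..1} \<Longrightarrow> \<gamma> t \<in> E" "\<gamma> 0 = e"
    "\<And>t. t \<in> {0..1} \<Longrightarrow> q (\<gamma> t) = \<alpha> t"
  shows "path_lift E q e \<alpha> \<gamma>"
  using assms by (auto simp: path_lift_def path_def path_image_def pathstart_def)

lemma path_lift_unique:
  assumes "covering_space E q B" "path_lift E q e \<alpha> \<gamma>" "path_lift E q e \<alpha> \<delta>" "t \<in> {0..1}"
  shows "\<gamma> t = \<delta> t"
  using covering_lift_unique_path[OF assms(1), of \<gamma> \<delta> t]
    path_liftD[OF assms(2)] path_liftD[OF assms(3)] assms(4) by simp

text \<open>The homotopy is lifted with the path parameter as time, while the homotopy parameter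
  runs over the space: all paths start at \<open>q e\<close>, so the constant \<open>e\<close> is an
  initial lift. The lifted end points then lie over the constant \<open>\<alpha> 1\<close>, and by
  unique lifting they do not move.\<close>

lemma path_lift_homotopic_same_end:
  assumes cov: "covering_space E q B" and e: "e \<in> E" and hom: "homotopic_paths B \<alpha> \<beta>"
    and \<gamma>: "path_lift E q e \<alpha> \<gamma>" and \<delta>: "path_lift E q e \<beta> \<delta>"
  shows "pathfinish \<gamma> = pathfinish \<delta>"
proof -
  have qe: "q e = \<alpha> 0" using path_liftD[OF \<gamma>] by auto
  obtain h where h: "continuous_on ({0..1} \<times> {0..1}) h" "h \<in> {0..1} \<times> {0..1} \<rightarrow> B"
    "\<And>x. x \<in> {0..1} \<Longrightarrow> h (0, x) = \<alpha> x" "\<And>x. x \<in> {0..1} \<Longrightarrow> h (1, x) = \<beta> x"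
    "\<And>t::real. t \<in> {0..1} \<Longrightarrow> h (t, 0) = \<alpha> 0" "\<And>t. t \<in> {0..1} \<Longrightarrow> h (t, 1) = \<alpha> 1"
    using hom unfolding homotopic_paths pathstart_def pathfinish_def by auto
  obtain K where K: "continuous_on ({0..1} \<times> {0..1}) K" "K \<in> {0..1} \<times> {0..1} \<rightarrow> E"
    "\<And>t. t \<in> {0..1} \<Longrightarrow> K (t, 0) = e" "\<And>w. w \<in> {0..1} \<times> {0..1} \<Longrightarrow> q (K w) = h w"
    using covering_homotopy_lift[OF cov h(1,2), of "\<lambda>_. e"] e h(5) qe by auto
  have c: "continuous_on {0..1} (\<lambda>x. K (t, x))" "continuous_on {0..1} (\<lambda>x. K (x, t))"
    if "t \<in> {0..1}" for t
    by (rule continuous_on_compose2[OF K(1)], use that in \<open>auto intro!: continuous_intros\<close>)+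
  have "path_lift E q e \<alpha> (\<lambda>x. K (0, x))" "path_lift E q e \<beta> (\<lambda>x. K (1, x))"
    using c K h by (auto intro!: path_liftI)
  then have "\<gamma> 1 = K (0, 1)" "\<delta> 1 = K (1, 1)"
    using path_lift_unique[OF cov] \<gamma> \<delta> by (metis atLeastAtMost_iff order_refl zero_le_one)+
  moreover have "K (1, 1) = K (0, 1)"
    by (rule covering_lift_unique_path[OF cov, of "\<lambda>t. K (t, 1)" "\<lambda>_. K (0, 1)" 1])
      (use c K h in auto)
  ultimately show ?thesis by (simp add: pathfinish_def)
qed

section \<open>Paths in simply connected sets\<close>

lemma simply_connected_imp_path:
  assumes "simply_connected S" "a \<in> S" "b \<in> S"
  obtains \<gamma> where "path \<gamma>" "path_image \<gamma> \<subseteq> S" "pathstart \<gamma> = a" "pathfinish \<gamma> = b"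
proof -
  \<comment> \<open>The definition of \<open>simply_connected\<close> also compares loops with
    different base points. During a free homotopy between constant loops the base point runs along a
    path from \<open>a\<close> to \<open>b\<close>.\<close>
  have "homotopic_loops S (\<lambda>_. a) (\<lambda>_. b)"
    by (rule assms(1)[unfolded simply_connected_def, rule_format])
      (use assms in \<open>auto simp: path_def path_image_def pathstart_def pathfinish_def\<close>)
  then obtain h where h: "continuous_on ({0..1::real} \<times> {0..1::real}) h" "h \<in> {0..1} \<times> {0..1} \<rightarrow> S"
    "\<And>x. x \<in> {0..1} \<Longrightarrow> h (0, x) = a" "\<And>x. x \<in> {0..1} \<Longrightarrow> h (1, x) = b"
    unfolding homotopic_loops by auto
  have "continuous_on {0..1} (\<lambda>t. h (t, 0))"
    by (rule continuous_on_compose2[OF h(1)]) (auto intro!: continuous_intros)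
  then show ?thesis
    using h by (intro that[of "\<lambda>t. h (t, 0)"])
      (auto simp: path_def path_image_def pathstart_def pathfinish_def)
qed

lemma simply_connected_imp_connected_space:
  assumes "simply_connected S"
  shows "connected S"
  using assms simply_connected_imp_path
  by (metis path_connected_def path_connected_imp_connected)

text \<open>This replaces explicit formulas for homotopies: with a square as \<open>C\<close>, a map
  of the square relates its values along different routes with the same ends.\<close>

lemma homotopic_paths_convex_image:
  fixes C :: "'c::real_normed_vector set"
  assumes "convex C" "continuous_on C k" "k \<in> C \<rightarrow> S" "path g" "path h" "path_image g \<subseteq> C" "path_image h \<subseteq> C"
    "pathstart g = pathstart h" "pathfinish g = pathfinish h"
  shows "homotopic_paths S (k \<circ> g) (k \<circ> h)"
proof -
  have "homotopic_paths C g h"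
    using convex_imp_simply_connected[OF \<open>convex C\<close>] assms
    unfolding simply_connected_eq_homotopic_paths by metis
  then show ?thesis
    using homotopic_paths_continuous_image assms by blast
qed

lemma homotopic_paths_const_join:
  assumes "path \<gamma>" "path_image \<gamma> \<subseteq> S"
  shows "homotopic_paths S ((\<lambda>_. pathstart \<gamma>) +++ \<gamma>) \<gamma>"
proof (rule homotopic_paths_sym, rule homotopic_paths_reparametrize[OF assms, where f = "\<lambda>t. max 0 (2 * t - 1)"])
  \<comment> \<open>The reparametrization waits at 0 during the first half, as the constant path
    does.\<close>
  show "continuous_on {0..1} (\<lambda>t::real. max 0 (2 * t - 1))"
    by (intro continuous_intros)
  show "((\<lambda>_. pathstart \<gamma>) +++ \<gamma>) t = \<gamma> (max 0 (2 * t - 1))" for t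
    by (cases "t \<le> 1/2") (auto simp: joinpaths_def pathstart_def max_def intro!: arg_cong[of _ _ \<gamma>])
qed (auto simp: max_def)

text \<open>The loop formed by \<gamma> and the reverse of \<delta> is freely null-homotopic, which
  gives a map \<open>h\<close> of the square. It is the loop on the left side, constant on the right
  side, and the track of the base point on the other two. Going round, that track is walked forth
  and back, so it cancels.\<close>

lemma simply_connected_imp_homotopic_paths:
  assumes S: "simply_connected S"
    and \<gamma>: "path \<gamma>" "path_image \<gamma> \<subseteq> S" and \<delta>: "path \<delta>" "path_image \<delta> \<subseteq> S"
    and ends: "pathstart \<gamma> = pathstart \<delta>" "pathfinish \<gamma> = pathfinish \<delta>"
  shows "homotopic_paths S \<gamma> \<delta>"
proof -
  define e where "e = pathstart \<gamma>"
  let ?l = "\<gamma> +++ reversepath \<delta>"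
  have "e \<in> S" using \<gamma> unfolding e_def by (metis pathstart_in_path_image subsetD)
  have "path ?l" "path_image ?l \<subseteq> S" "pathfinish ?l = pathstart ?l"
    using \<gamma> \<delta> ends by (simp_all add: subset_path_image_join)
  moreover have "path (\<lambda>_::real. e)" "path_image (\<lambda>_. e) \<subseteq> S" "pathfinish (\<lambda>_. e) = pathstart (\<lambda>_. e)"
    using \<open>e \<in> S\<close> by (auto simp: path_def path_image_def pathstart_def pathfinish_def)
  ultimately have "homotopic_loops S ?l (\<lambda>_. e)"
    using S unfolding simply_connected_def by blast
  then obtain h where h: "continuous_on ({0..1::real} \<times> {0..1::real}) h" "h \<in> {0..1} \<times> {0..1} \<rightarrow> S"
    "\<And>x. x \<in> {0..1} \<Longrightarrow> h (0, x) = ?l x" "\<And>x. x \<in> {0..1} \<Longrightarrow> h (1, x) = e"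
    "\<And>t. t \<in> {0..1} \<Longrightarrow> h (t, 1) = h (t, 0)"
    unfolding homotopic_loops pathstart_def pathfinish_def by auto
  let ?Q = "{0..1::real} \<times> {0..1::real}"
  have Q: "convex ?Q" by (intro convex_Times) auto
  \<comment> \<open>\<open>?b\<close> takes the three other sides from \<open>(0,0)\<close> to
    \<open>(0,1)\<close>, and \<open>?c\<close> descends the left side to \<open>(0,1/2)\<close>,
    where \<open>h\<close> traces \<delta>. Together they have the same ends as the lower half of
    the left side, where \<open>h\<close> traces \<gamma>.\<close>
  let ?b = "linepath (0,0) (1,0) +++ linepath (1,0) (1,1) +++ linepath (1,1) (0,1::real) :: real \<Rightarrow> real \<times> real"
  let ?c = "linepath (0,1) (0,1/2) :: real \<Rightarrow> real \<times> real"
  have seg: "path_image (linepath u v) \<subseteq> ?Q" if "u \<in> ?Q" "v \<in> ?Q" for u v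
    using that Q by (simp add: closed_segment_subset)
  have b: "path ?b" "path_image ?b \<subseteq> ?Q" "path_image ?c \<subseteq> ?Q" "path_image (linepath (0,0) (0,1/2::real)) \<subseteq> ?Q"
    by (simp, (intro subset_path_image_join seg; simp)+)
  have "homotopic_paths S (h \<circ> linepath (0,0) (0,1/2)) (h \<circ> (?b +++ ?c))"
    by (rule homotopic_paths_convex_image[OF Q h(1,2)])
      (use b in \<open>simp_all add: subset_path_image_join del: path_image_linepath\<close>)
  then have "homotopic_paths S (h \<circ> linepath (0,0) (0,1/2)) ((h \<circ> ?b) +++ (h \<circ> ?c))"
    by (subst (asm) path_compose_join)
  moreover have "homotopic_paths S \<gamma> (h \<circ> linepath (0,0) (0,1/2))"
    by (rule homotopic_paths_eq[OF \<gamma>]) (auto simp: linepath_def h(3) joinpaths_def)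
  moreover have "homotopic_paths S ((h \<circ> ?b) +++ (h \<circ> ?c)) ((\<lambda>_. e) +++ \<delta>)"
  proof (rule homotopic_paths_join)
    \<comment> \<open>Along \<open>?b\<close> the map \<open>h\<close> agrees with
      \<open>h (fst w, 0)\<close>, which is constant on vertical lines. For the latter,
      \<open>?b\<close> may be exchanged for the left side, and the result is the constant path at
      \<open>e\<close>.\<close>
    have kc: "continuous_on ?Q (\<lambda>w. h (fst w, 0))"
      by (rule continuous_on_compose2[OF h(1)]) (auto intro!: continuous_intros)
    have "homotopic_paths S ((\<lambda>w. h (fst w, 0)) \<circ> ?b) ((\<lambda>w. h (fst w, 0)) \<circ> linepath (0,0) (0,1::real))"
      by (rule homotopic_paths_convex_image[OF Q kc])
        (use b h(2) seg[of "(0,0)" "(0,1)"] in \<open>auto simp del: path_image_linepath\<close>)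
    moreover have "((\<lambda>w. h (fst w, 0)) \<circ> linepath (0,0) (0,1::real)) = (\<lambda>_. e)"
      using h(3)[of 0] by (auto simp: linepath_def fun_eq_iff joinpaths_def e_def pathstart_def)
    ultimately have A: "homotopic_paths S ((\<lambda>w. h (fst w, 0)) \<circ> ?b) (\<lambda>_. e)"
      by (simp only:)
    have B: "((\<lambda>w. h (fst w, 0)) \<circ> ?b) t = (h \<circ> ?b) t" if "t \<in> {0..1}" for t
    proof -
      have "snd (?b t) = 0 \<or> snd (?b t) = 1 \<or> fst (?b t) = 1"
        by (simp add: joinpaths_def linepath_def)
      moreover have "?b t \<in> ?Q" using b(2) that unfolding path_image_def by blast
      ultimately show ?thesis
        using h(4)[of 0] h(4)[of "snd (?b t)"] h(5)[of "fst (?b t)"]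
        by (cases "?b t") auto
    qed
    have "homotopic_paths S ((\<lambda>w. h (fst w, 0)) \<circ> ?b) (h \<circ> ?b)"
      using homotopic_paths_imp_path[OF A] homotopic_paths_imp_subset[OF A] B
      by (intro homotopic_paths_eq) (elim conjE, assumption)+
    from homotopic_paths_trans[OF homotopic_paths_sym[OF this] A]
    show "homotopic_paths S (h \<circ> ?b) (\<lambda>_. e)" .
    have "homotopic_paths S \<delta> (h \<circ> ?c)"
      by (rule homotopic_paths_eq[OF \<delta>])
        (use ends in \<open>auto simp: linepath_def h(3) joinpaths_def reversepath_def pathfinish_def\<close>)
    then show "homotopic_paths S (h \<circ> ?c) \<delta>" by (rule homotopic_paths_sym)
  qed (simp add: pathfinish_compose pathstart_compose)
  moreover have "homotopic_paths S ((\<lambda>_. e) +++ \<delta>) \<delta>"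
    using homotopic_paths_const_join[OF \<delta>] ends by (simp add: e_def)
  ultimately show ?thesis by (meson homotopic_paths_trans)
qed

subsection \<open>Deck transformations and the fundamental group\<close>

lemma deck_transformationD:
  assumes "h \<in> deck_transformations E q"
  shows "continuous_on E h" "h \<in> E \<rightarrow> E" "e \<in> E \<Longrightarrow> h e \<in> E" "e \<in> E \<Longrightarrow> q (h e) = q e" "h \<in> Bij E"
  using assms unfolding deck_transformations_def Bij_def homeomorphism_def
  by (auto simp: bij_betw_def inj_on_def) metis

lemma deck_transformation_compose:
  assumes "g \<in> deck_transformations E q" "h \<in> deck_transformations E q"
  shows "compose E g h \<in> deck_transformations E q"
proof -
  obtain g' h' where "homeomorphism E E g g'" "homeomorphism E E h h'"
    using assms by (auto simp: deck_transformations_def)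
  then have "homeomorphism E E (g \<circ> h) (h' \<circ> g')"
    using homeomorphism_compose by blast
  then have "homeomorphism E E (compose E g h) (h' \<circ> g')"
    by (rule homeomorphism_cong) (auto simp: compose_def)
  then show ?thesis
    using deck_transformationD[OF assms(1)] deck_transformationD[OF assms(2)]
    by (auto simp: deck_transformations_def compose_def)
qed

lemma deck_transformation_id: "(\<lambda>x\<in>E. x) \<in> deck_transformations E q"
proof -
  have "homeomorphism E E (\<lambda>x\<in>E. x) (\<lambda>x. x)"
    by (rule homeomorphism_cong[OF homeomorphism_ident]) auto
  then show ?thesis by (auto simp: deck_transformations_def)
qed

lemma deck_transformation_inverse:
  assumes h: "h \<in> deck_transformations E q"
  shows "restrict (inv_into E h) E \<in> deck_transformations E q"
    and "e \<in> E \<Longrightarrow> inv_into E h (h e) = e" and "e \<in> E \<Longrightarrow> h (inv_into E h e) = e"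
proof -
  obtain k where k: "homeomorphism E E h k" using h by (auto simp: deck_transformations_def)
  have bij: "bij_betw h E E" using deck_transformationD(5)[OF h] by (simp add: Bij_def)
  show i: "e \<in> E \<Longrightarrow> inv_into E h (h e) = e" and r: "e \<in> E \<Longrightarrow> h (inv_into E h e) = e" for e
    using bij by (auto simp: bij_betw_def f_inv_into_f)
  have eq: "inv_into E h e = k e" if "e \<in> E" for e
  proof -
    have "k e \<in> E" "h (k e) = e" using k that by (auto simp: homeomorphism_def)
    then show ?thesis using i[of "k e"] by simp
  qed
  have "homeomorphism E E k h" using k homeomorphism_symD by blast
  then have "homeomorphism E E (restrict (inv_into E h) E) h"
    by (rule homeomorphism_cong) (auto simp: eq)
  moreover have "q (inv_into E h e) = q e" if "e \<in> E" for e
  proof -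
    have "inv_into E h e \<in> E" using eq k that by (auto simp: homeomorphism_def)
    then show ?thesis using deck_transformationD(4)[OF h] r[OF that] by metis
  qed
  ultimately show "restrict (inv_into E h) E \<in> deck_transformations E q"
    by (auto simp: deck_transformations_def)
qed

lemma deck_transformations_subgroup: "subgroup (deck_transformations E q) (BijGroup E)"
proof (rule group.subgroupI[OF group_BijGroup])
  show "deck_transformations E q \<subseteq> carrier (BijGroup E)"
    using deck_transformationD(5) by (auto simp: BijGroup_def)
  show "deck_transformations E q \<noteq> {}" using deck_transformation_id by blast
  fix a b assume "a \<in> deck_transformations E q" "b \<in> deck_transformations E q"
  moreover from this have "a \<in> Bij E" "b \<in> Bij E" by (auto dest: deck_transformationD(5))
  ultimately show "inv\<^bsub>BijGroup E\<^esub> a \<in> deck_transformations E q"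
      "a \<otimes>\<^bsub>BijGroup E\<^esub> b \<in> deck_transformations E q"
    using deck_transformation_inverse(1)[of a E q] deck_transformation_compose[of a E q b]
    by (simp_all add: inv_BijGroup) (simp add: BijGroup_def)
qed

lemma group_deck_group: "group (deck_group E q)"
  unfolding deck_group_def
  using subgroup.subgroup_is_group[OF deck_transformations_subgroup group_BijGroup] .

lemma carrier_deck_group [simp]: "carrier (deck_group E q) = deck_transformations E q"
  by (simp add: deck_group_def)

lemma mult_deck_group:
  "\<lbrakk>g \<in> deck_transformations E q; h \<in> deck_transformations E q\<rbrakk> \<Longrightarrow> g \<otimes>\<^bsub>deck_group E q\<^esub> h = compose E g h"
  using deck_transformationD(5)[of g E q] deck_transformationD(5)[of h E q]
  by (simp add: deck_group_def BijGroup_def)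

lemma one_deck_group: "\<one>\<^bsub>deck_group E q\<^esub> = (\<lambda>x\<in>E. x)"
  by (simp add: deck_group_def BijGroup_def)

lemma inv_deck_group:
  assumes "h \<in> deck_transformations E q"
  shows "inv\<^bsub>deck_group E q\<^esub> h = restrict (inv_into E h) E"
proof -
  have "inv\<^bsub>deck_group E q\<^esub> h = inv\<^bsub>BijGroup E\<^esub> h"
    unfolding deck_group_def
    by (rule group.m_inv_consistent[OF group_BijGroup deck_transformations_subgroup assms])
  then show ?thesis using assms by (simp add: inv_BijGroup deck_transformationD(5))
qed

section \<open>Loop classes and the canonical map\<close>

lemma loop_class_eq:
  assumes "homotopic_paths Y \<alpha> \<beta>"
  shows "loop_class Y \<alpha> = loop_class Y \<beta>"
  using assms homotopic_paths_sym homotopic_paths_trans unfolding loop_class_def by blast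

lemma loop_class_self:
  assumes "\<alpha> \<in> loops Y y"
  shows "\<alpha> \<in> loop_class Y \<alpha>"
  using assms by (simp add: loop_class_def loops_def)

lemma loops_join: "\<lbrakk>\<alpha> \<in> loops Y y; \<beta> \<in> loops Y y\<rbrakk> \<Longrightarrow> \<alpha> +++ \<beta> \<in> loops Y y"
  by (simp add: loops_def subset_path_image_join)

lemma mult_fundamental_group:
  assumes "\<alpha> \<in> loops Y y" "\<beta> \<in> loops Y y"
  shows "loop_class Y \<alpha> \<otimes>\<^bsub>fundamental_group Y y\<^esub> loop_class Y \<beta> = loop_class Y (\<alpha> +++ \<beta>)"
proof -
  have "loop_class Y (\<alpha>' +++ \<beta>') = loop_class Y (\<alpha> +++ \<beta>)"
    if "\<alpha>' \<in> loop_class Y \<alpha>" "\<beta>' \<in> loop_class Y \<beta>" for \<alpha>' \<beta>'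
    using that assms loop_class_eq[OF homotopic_paths_join[of Y \<alpha> \<alpha>' \<beta> \<beta>']]
    by (simp add: loop_class_def loops_def)
  \<comment> \<open>A union with constant members equals that member only over non-empty index
    sets.\<close>
  moreover have "loop_class Y \<alpha> \<noteq> {}" "loop_class Y \<beta> \<noteq> {}" using assms loop_class_self by blast+
  ultimately have "(\<Union>\<alpha>'\<in>loop_class Y \<alpha>. \<Union>\<beta>'\<in>loop_class Y \<beta>. loop_class Y (\<alpha>' +++ \<beta>')) = loop_class Y (\<alpha> +++ \<beta>)"
    by simp
  then show ?thesis by (simp add: fundamental_group_def)
qed

lemma carrier_fundamental_group: "carrier (fundamental_group Y y) = loop_class Y ` loops Y y"
  by (simp add: fundamental_group_def)

lemma one_fundamental_group: "\<one>\<^bsub>fundamental_group Y y\<^esub> = loop_class Y (\<lambda>_. y)"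
  by (simp add: fundamental_group_def)

lemma const_loop: "y \<in> Y \<Longrightarrow> (\<lambda>_. y) \<in> loops Y y"
  by (auto simp: loops_def path_def path_image_def pathstart_def pathfinish_def)

text \<open>Homotopic loops have lifts with the same end, so the description in
  \<open>canonical_map\<close> can be evaluated at one representative and one lift. Simple
  transitivity on the fibre makes the described element exist and be unique.\<close>

lemma canonical_map_lift:
  assumes uc: "universal_covering E q B" and e: "e \<in> E" and \<alpha>: "\<alpha> \<in> loops B (q e)"
    and \<gamma>: "path_lift E q e \<alpha> \<gamma>"
  shows "canonical_map E q e (loop_class B \<alpha>) \<in> deck_transformations E q"
    and "canonical_map E q e (loop_class B \<alpha>) e = pathfinish \<gamma>"
proof -
  have cov: "covering_space E q B" using uc by (simp add: universal_covering_def)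
  have "pathfinish \<gamma> \<in> E" "q e = q (pathfinish \<gamma>)"
    using path_liftD[OF \<gamma>] \<alpha> by (auto simp: loops_def pathfinish_def)
  then have ex: "\<exists>!h. h \<in> deck_transformations E q \<and> h e = pathfinish \<gamma>"
    using uc e by (simp add: universal_covering_def)
  have "(\<exists>\<alpha>'\<in>loop_class B \<alpha>. \<exists>\<gamma>'. path_lift E q e \<alpha>' \<gamma>' \<and> h e = pathfinish \<gamma>') \<longleftrightarrow> h e = pathfinish \<gamma>" for h
  proof
    assume "\<exists>\<alpha>'\<in>loop_class B \<alpha>. \<exists>\<gamma>'. path_lift E q e \<alpha>' \<gamma>' \<and> h e = pathfinish \<gamma>'"
    then obtain \<alpha>' \<gamma>' where "homotopic_paths B \<alpha> \<alpha>'" "path_lift E q e \<alpha>' \<gamma>'" "h e = pathfinish \<gamma>'"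
      by (auto simp: loop_class_def)
    then show "h e = pathfinish \<gamma>" using path_lift_homotopic_same_end[OF cov e _ \<gamma>] by metis
  qed (use loop_class_self[OF \<alpha>] \<gamma> in blast)
  then have "canonical_map E q e (loop_class B \<alpha>) = (THE h. h \<in> deck_transformations E q \<and> h e = pathfinish \<gamma>)"
    by (simp add: canonical_map_def)
  with theI'[OF ex] show "canonical_map E q e (loop_class B \<alpha>) \<in> deck_transformations E q"
    and "canonical_map E q e (loop_class B \<alpha>) e = pathfinish \<gamma>" by auto
qed

lemma deck_transformation_eqI:
  assumes "universal_covering E q B" "e \<in> E" "g \<in> deck_transformations E q" "h \<in> deck_transformations E q" "g e = h e"
  shows "g = h"
proof -
  have "\<exists>!k. k \<in> deck_transformations E q \<and> k e = h e"
    using assms(1,2) deck_transformationD(3,4)[OF assms(4)] by (auto simp: universal_covering_def)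
  then show ?thesis using assms by blast
qed

lemma loop_path_lift_exists:
  assumes "universal_covering E q B" "e \<in> E" "\<alpha> \<in> loops B (q e)"
  obtains \<gamma> where "path_lift E q e \<alpha> \<gamma>"
  using path_lift_exists[of E q B e \<alpha>] assms by (auto simp: universal_covering_def loops_def)

text \<open>The lift of \<beta> that continues \<gamma> has to start at \<open>h e\<close>, and the
  translate by \<open>h\<close> of the lift from \<open>e\<close> does. Hence the canonical map
  preserves the order of products instead of reversing it.\<close>

lemma path_lift_join_deck:
  assumes \<gamma>: "path_lift E q e \<alpha> \<gamma>" and \<delta>: "path_lift E q e \<beta> \<delta>"
    and h: "h \<in> deck_transformations E q" "h e = pathfinish \<gamma>"
  shows "path_lift E q e (\<alpha> +++ \<beta>) (\<gamma> +++ (h \<circ> \<delta>))"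
proof -
  note \<gamma>' = \<gamma>[unfolded path_lift_def] and \<delta>' = \<delta>[unfolded path_lift_def]
  note h' = deck_transformationD[OF h(1)]
  have "path (h \<circ> \<delta>)"
    using \<delta>' h' by (intro path_continuous_image) (auto intro: continuous_on_subset)
  moreover have "path_image (h \<circ> \<delta>) \<subseteq> E"
    using \<delta>' h' by (auto simp: path_image_compose)
  moreover have "q ((h \<circ> \<delta>) t) = \<beta> t" if "t \<in> {0..1}" for t
    using path_liftD[OF \<delta>] that h' by auto
  ultimately show ?thesis
    using \<gamma>' \<delta>' h unfolding path_lift_def
    by (simp add: subset_path_image_join pathstart_compose) (simp add: joinpaths_def)
qed

text \<open>Both halves of bijectivity come from the simple connectedness of \<open>E\<close>: lifts
  with common ends are homotopic, and every \<open>h e\<close> is reached from \<open>e\<close> by a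
  path, which projects to a loop. The unit is stated separately because the fundamental group is not
  yet known to be a group.\<close>

lemma canonical_map_iso:
  assumes uc: "universal_covering E q B" and e: "e \<in> E"
  shows "canonical_map E q e \<in> iso (fundamental_group B (q e)) (deck_group E q)"
    and "canonical_map E q e \<one>\<^bsub>fundamental_group B (q e)\<^esub> = \<one>\<^bsub>deck_group E q\<^esub>"
proof -
  let ?T = "canonical_map E q e" and ?P = "fundamental_group B (q e)"
  have cov: "covering_space E q B" and sc: "simply_connected E"
    using uc by (auto simp: universal_covering_def)
  have qc: "continuous_on E q" "q ` E = B" using cov by (auto simp: covering_space_def)
  show "?T \<one>\<^bsub>?P\<^esub> = \<one>\<^bsub>deck_group E q\<^esub>"
  proof -
    have l: "(\<lambda>_. q e) \<in> loops B (q e)" using qc e by (auto intro: const_loop)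
    have "path_lift E q e (\<lambda>_. q e) (\<lambda>_. e)" using e by (intro path_liftI) auto
    from canonical_map_lift[OF uc e l this]
    have "?T (loop_class B (\<lambda>_. q e)) = (\<lambda>x\<in>E. x)"
      using deck_transformation_eqI[OF uc e _ deck_transformation_id] e by (simp add: pathfinish_def)
    then show ?thesis by (simp add: one_fundamental_group one_deck_group)
  qed
  have mem: "?T c \<in> deck_transformations E q" if "c \<in> carrier ?P" for c
  proof -
    obtain \<alpha> where \<alpha>: "\<alpha> \<in> loops B (q e)" "c = loop_class B \<alpha>"
      using \<open>c \<in> carrier ?P\<close> by (auto simp: carrier_fundamental_group)
    obtain \<gamma> where "path_lift E q e \<alpha> \<gamma>" by (rule loop_path_lift_exists[OF uc e \<alpha>(1)])
    then show ?thesis using canonical_map_lift(1)[OF uc e \<alpha>(1)] \<alpha>(2) by simp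
  qed
  have "?T \<in> hom ?P (deck_group E q)"
  proof (rule homI)
    fix c d assume "c \<in> carrier ?P" "d \<in> carrier ?P"
    then obtain \<alpha> \<beta> where \<alpha>: "\<alpha> \<in> loops B (q e)" "c = loop_class B \<alpha>"
      and \<beta>: "\<beta> \<in> loops B (q e)" "d = loop_class B \<beta>"
      by (auto simp: carrier_fundamental_group)
    obtain \<gamma> where \<gamma>: "path_lift E q e \<alpha> \<gamma>" by (rule loop_path_lift_exists[OF uc e \<alpha>(1)])
    obtain \<delta> where \<delta>: "path_lift E q e \<beta> \<delta>" by (rule loop_path_lift_exists[OF uc e \<beta>(1)])
    note 1 = canonical_map_lift[OF uc e \<alpha>(1) \<gamma>] and 2 = canonical_map_lift[OF uc e \<beta>(1) \<delta>]
    note 3 = canonical_map_lift[OF uc e loops_join[OF \<alpha>(1) \<beta>(1)] path_lift_join_deck[OF \<gamma> \<delta> 1]]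
    have "?T (loop_class B (\<alpha> +++ \<beta>)) = compose E (?T c) (?T d)"
      by (rule deck_transformation_eqI[OF uc e 3(1) deck_transformation_compose])
        (use 1 2 3(2) e \<alpha> \<beta> in \<open>auto simp: compose_def pathfinish_compose\<close>)
    then show "?T (c \<otimes>\<^bsub>?P\<^esub> d) = ?T c \<otimes>\<^bsub>deck_group E q\<^esub> ?T d"
      using \<alpha> \<beta> 1(1) 2(1) by (simp add: mult_fundamental_group mult_deck_group)
  qed (simp add: mem)
  moreover have "inj_on ?T (carrier ?P)"
  proof (rule inj_onI)
    fix c d assume "c \<in> carrier ?P" "d \<in> carrier ?P" and eq: "?T c = ?T d"
    then obtain \<alpha> \<beta> where \<alpha>: "\<alpha> \<in> loops B (q e)" "c = loop_class B \<alpha>"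
      and \<beta>: "\<beta> \<in> loops B (q e)" "d = loop_class B \<beta>"
      by (auto simp: carrier_fundamental_group)
    obtain \<gamma> where \<gamma>: "path_lift E q e \<alpha> \<gamma>" by (rule loop_path_lift_exists[OF uc e \<alpha>(1)])
    obtain \<delta> where \<delta>: "path_lift E q e \<beta> \<delta>" by (rule loop_path_lift_exists[OF uc e \<beta>(1)])
    have "pathfinish \<gamma> = pathfinish \<delta>"
      using canonical_map_lift(2)[OF uc e \<alpha>(1) \<gamma>] canonical_map_lift(2)[OF uc e \<beta>(1) \<delta>] eq \<alpha> \<beta> by simp
    then have "homotopic_paths E \<gamma> \<delta>"
      using \<gamma> \<delta> by (intro simply_connected_imp_homotopic_paths[OF sc]) (auto simp: path_lift_def)
    then have "homotopic_paths B (q \<circ> \<gamma>) (q \<circ> \<delta>)"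
      using homotopic_paths_continuous_image qc by blast
    moreover have "homotopic_paths B \<alpha> (q \<circ> \<gamma>)"
      using \<alpha>(1) path_liftD(4)[OF \<gamma>] by (intro homotopic_paths_eq) (auto simp: loops_def)
    moreover have "homotopic_paths B \<beta> (q \<circ> \<delta>)"
      using \<beta>(1) path_liftD(4)[OF \<delta>] by (intro homotopic_paths_eq) (auto simp: loops_def)
    ultimately have "homotopic_paths B \<alpha> \<beta>"
      by (meson homotopic_paths_sym homotopic_paths_trans)
    then show "c = d" using loop_class_eq \<alpha> \<beta> by simp
  qed
  moreover have "h \<in> ?T ` carrier ?P" if h: "h \<in> deck_transformations E q" for h
  proof -
    obtain \<gamma> where \<gamma>: "path \<gamma>" "path_image \<gamma> \<subseteq> E" "pathstart \<gamma> = e" "pathfinish \<gamma> = h e"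
      using simply_connected_imp_path[OF sc e deck_transformationD(3)[OF h e]] by metis
    have l: "q \<circ> \<gamma> \<in> loops B (q e)"
      using \<gamma> qc deck_transformationD(4)[OF h e]
      by (auto simp: loops_def path_image_compose pathstart_compose pathfinish_compose
          intro: path_continuous_image continuous_on_subset)
    have "path_lift E q e (q \<circ> \<gamma>) \<gamma>" using \<gamma> by (simp add: path_lift_def)
    from canonical_map_lift[OF uc e l this] have "?T (loop_class B (q \<circ> \<gamma>)) = h"
      using deck_transformation_eqI[OF uc e _ h] \<gamma> by simp
    then show ?thesis using l by (auto simp: carrier_fundamental_group)
  qed
  ultimately show "?T \<in> iso ?P (deck_group E q)"
    using mem by (auto simp: iso_def bij_betw_def)
qed

text \<open>Transporting the axioms along the canonical map avoids constructing the homotopies of the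
  path groupoid laws.\<close>

lemma group_if_iso_to_group:
  assumes D: "group D" and T: "T \<in> iso P D" and one: "\<one>\<^bsub>P\<^esub> \<in> carrier P" "T \<one>\<^bsub>P\<^esub> = \<one>\<^bsub>D\<^esub>"
    and closed: "\<And>x y. \<lbrakk>x \<in> carrier P; y \<in> carrier P\<rbrakk> \<Longrightarrow> x \<otimes>\<^bsub>P\<^esub> y \<in> carrier P"
  shows "group P"
proof -
  interpret D: group D by fact
  have hom: "T (x \<otimes>\<^bsub>P\<^esub> y) = T x \<otimes>\<^bsub>D\<^esub> T y" "T x \<in> carrier D" if "x \<in> carrier P" "y \<in> carrier P" for x y
    using T that by (auto simp: iso_def hom_def)
  have inj: "x = y" if "T x = T y" "x \<in> carrier P" "y \<in> carrier P" for x y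
    using T that by (auto simp: iso_def bij_betw_def inj_on_def)
  show ?thesis
  proof (rule groupI)
    fix x assume x: "x \<in> carrier P"
    then have "inv\<^bsub>D\<^esub> T x \<in> T ` carrier P"
      using T hom[OF x x] by (auto simp: iso_def bij_betw_def)
    then obtain y where y: "y \<in> carrier P" "T y = inv\<^bsub>D\<^esub> T x" by auto
    have "y \<otimes>\<^bsub>P\<^esub> x = \<one>\<^bsub>P\<^esub>"
      by (rule inj) (use x y hom one closed in auto)
    then show "\<exists>y\<in>carrier P. y \<otimes>\<^bsub>P\<^esub> x = \<one>\<^bsub>P\<^esub>" using y by blast
  next
    fix x y z assume "x \<in> carrier P" "y \<in> carrier P" "z \<in> carrier P"
    then show "x \<otimes>\<^bsub>P\<^esub> y \<otimes>\<^bsub>P\<^esub> z = x \<otimes>\<^bsub>P\<^esub> (y \<otimes>\<^bsub>P\<^esub> z)"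
      by (intro inj) (auto simp: hom closed D.m_assoc)
  next
    fix x assume "x \<in> carrier P"
    then show "\<one>\<^bsub>P\<^esub> \<otimes>\<^bsub>P\<^esub> x = x" by (intro inj) (auto simp: hom one closed)
  qed (use one closed in auto)
qed

lemma group_fundamental_group:
  assumes "universal_covering E q B" "e \<in> E"
  shows "group (fundamental_group B (q e))"
proof (rule group_if_iso_to_group[OF group_deck_group canonical_map_iso(1)[OF assms]])
  have "q e \<in> B" using assms by (auto simp: universal_covering_def covering_space_def)
  then show "\<one>\<^bsub>fundamental_group B (q e)\<^esub> \<in> carrier (fundamental_group B (q e))"
    by (simp add: one_fundamental_group carrier_fundamental_group const_loop)
  show "canonical_map E q e \<one>\<^bsub>fundamental_group B (q e)\<^esub> = \<one>\<^bsub>deck_group E q\<^esub>"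
    by (rule canonical_map_iso(2)[OF assms])
qed (auto simp: carrier_fundamental_group mult_fundamental_group loops_join)

subsection \<open>Cyclic homotopies\<close>

lemma continuous_on_parametrized_join:
  fixes P Q :: "'x::topological_space \<times> real \<Rightarrow> 'y::topological_space"
  assumes P: "continuous_on (X \<times> {0..1}) P" and Q: "continuous_on (X \<times> {0..1}) Q"
    and PQ: "\<And>x. x \<in> X \<Longrightarrow> P (x, 1) = Q (x, 0)"
  shows "continuous_on (X \<times> {0..1}) (\<lambda>w. ((\<lambda>s. P (fst w, s)) +++ (\<lambda>s. Q (fst w, s))) (snd w))"
  unfolding joinpaths_def
proof (rule continuous_on_cases_le)
  show "continuous_on {w \<in> X \<times> {0..1}. snd w \<le> 1/2} (\<lambda>w. P (fst w, 2 * snd w))"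
    by (rule continuous_on_compose2[OF P]) (auto intro!: continuous_intros)
  show "continuous_on {w \<in> X \<times> {0..1}. 1/2 \<le> snd w} (\<lambda>w. Q (fst w, 2 * snd w - 1))"
    by (rule continuous_on_compose2[OF Q]) (auto intro!: continuous_intros)
  show "P (fst w, 2 * snd w) = Q (fst w, 2 * snd w - 1)" if "w \<in> X \<times> {0..1}" "snd w = 1/2" for w
  proof -
    have "2 * snd w = 1" "fst w \<in> X" using that by auto
    then show ?thesis using PQ by (simp only:) simp
  qed
qed (auto intro!: continuous_intros)

text \<open>The interval form of the Gottlieb condition. That the loops \<open>H (x0, -)\<close>
  represent exactly the elements of \<open>gottlieb_group\<close> is the content of
  \<open>cyclic_homotopy_imp_gottlieb\<close> and
  \<open>gottlieb_imp_cyclic_homotopy\<close>.\<close>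

definition cyclic_homotopy ::
  "'x::topological_space set \<Rightarrow> 'y::topological_space set \<Rightarrow> ('x \<Rightarrow> 'y) \<Rightarrow> ('x \<times> real \<Rightarrow> 'y) \<Rightarrow> bool" where
  "cyclic_homotopy X Y f H \<longleftrightarrow> continuous_on (X \<times> {0..1}) H \<and> H \<in> X \<times> {0..1} \<rightarrow> Y \<and>
     (\<forall>x\<in>X. H (x, 0) = f x \<and> H (x, 1) = f x)"

lemma cyclic_homotopy_loop:
  assumes "cyclic_homotopy X Y f H" "x \<in> X"
  shows "(\<lambda>t. H (x, t)) \<in> loops Y (f x)"
proof -
  have "continuous_on {0..1} (\<lambda>t. H (x, t))"
    by (rule continuous_on_compose2[of "X \<times> {0..1}" H])
      (use assms in \<open>auto simp: cyclic_homotopy_def intro!: continuous_intros\<close>)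
  then show ?thesis
    using assms by (auto simp: cyclic_homotopy_def loops_def path_def path_image_def pathstart_def pathfinish_def)
qed

text \<open>On the unit circle, the inverse of \<open>cis (2 * pi * t)\<close> for
  \<open>0 < t \<le> 1\<close>. The point 1 gets the parameter 1, not 0; the jump there does no harm
  to functions with equal values at 0 and 1.\<close>

definition circle_parameter :: "complex \<Rightarrow> real" where
  "circle_parameter z = (if Im z \<le> 0 then 1 - arccos (Re z) / (2 * pi) else arccos (Re z) / (2 * pi))"

lemma Re_sphere_bounds:
  assumes "z \<in> sphere (0::complex) 1"
  shows "-1 \<le> Re z" "Re z \<le> 1"
  using assms abs_Re_le_cmod[of z] by (auto simp: abs_le_iff)

lemma circle_parameter_cis:
  assumes "0 < t" "t \<le> 1"
  shows "circle_parameter (cis (2 * pi * t)) = t"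
proof (cases "t < 1/2")
  case True
  then have "2 * pi * t < pi" using pi_gt_zero by simp
  then have "0 < sin (2 * pi * t)" "arccos (cos (2 * pi * t)) = 2 * pi * t"
    using assms by (auto intro!: sin_gt_zero arccos_cos)
  then show ?thesis by (simp add: circle_parameter_def)
next
  case False
  \<comment> \<open>Here the angle is at least \<open>pi\<close>, so \<open>arccos\<close> returns
    its reflection \<open>2 * pi - 2 * pi * t\<close>.\<close>
  then have t: "0 \<le> 2 * pi - 2 * pi * t" "2 * pi - 2 * pi * t \<le> pi" using assms pi_gt_zero by auto
  have "sin (2 * pi * t) = - sin (2 * pi - 2 * pi * t)" "cos (2 * pi * t) = cos (2 * pi - 2 * pi * t)"
    by (simp_all add: sin_diff cos_diff)
  then have "sin (2 * pi * t) \<le> 0" "arccos (cos (2 * pi * t)) = 2 * pi - 2 * pi * t"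
    using sin_ge_zero[OF t] arccos_cos[OF t] by auto
  then show ?thesis by (simp add: circle_parameter_def field_simps)
qed

lemma cyclic_homotopy_on_circle:
  assumes H: "cyclic_homotopy X Y f H"
  obtains F where "continuous_on (X \<times> sphere 0 1) F" "F \<in> X \<times> sphere 0 1 \<rightarrow> Y"
    "\<And>x t. x \<in> X \<Longrightarrow> t \<in> {0..1} \<Longrightarrow> F (x, cis (2 * pi * t)) = H (x, t)"
    "\<And>x. x \<in> X \<Longrightarrow> F (x, 1) = f x"
proof
  define F where "F = (\<lambda>w. H (fst w, circle_parameter (snd w)))"
  have Hc: "continuous_on (X \<times> {0..1}) H" and HY: "H \<in> X \<times> {0..1} \<rightarrow> Y"
    and H01: "\<And>x. x \<in> X \<Longrightarrow> H (x, 0) = f x" "\<And>x. x \<in> X \<Longrightarrow> H (x, 1) = f x"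
    using H by (auto simp: cyclic_homotopy_def)
  have ac: "0 \<le> arccos (Re z) / (2 * pi)" "arccos (Re z) / (2 * pi) \<le> 1" if "cmod z = 1" for z
    using arccos_bounded[of "Re z"] Re_sphere_bounds[of z] that by (auto simp: field_simps)
  have cac: "continuous_on (X \<times> sphere 0 1) (\<lambda>w. arccos (Re (snd w)) / (2 * pi))"
    using Re_sphere_bounds by (intro continuous_intros) fastforce+
  have F: "F = (\<lambda>w. if Im (snd w) \<le> 0 then H (fst w, 1 - arccos (Re (snd w)) / (2 * pi))
      else H (fst w, arccos (Re (snd w)) / (2 * pi)))"
    by (auto simp: F_def circle_parameter_def)
  show "continuous_on (X \<times> sphere 0 1) F"
    unfolding F
  proof (rule continuous_on_cases_le)
    show "continuous_on {w \<in> X \<times> sphere 0 1. 0 \<le> Im (snd w)} (\<lambda>w. H (fst w, arccos (Re (snd w)) / (2 * pi)))"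
    proof (rule continuous_on_compose2[OF Hc])
      show "continuous_on {w \<in> X \<times> sphere 0 1. 0 \<le> Im (snd w)} (\<lambda>w. (fst w, arccos (Re (snd w)) / (2 * pi)))"
        by (intro continuous_on_Pair continuous_on_subset[OF cac] continuous_intros) auto
      show "(\<lambda>w. (fst w, arccos (Re (snd w)) / (2 * pi))) ` {w \<in> X \<times> sphere 0 1. 0 \<le> Im (snd w)} \<subseteq> X \<times> {0..1}"
        using ac by auto
    qed
    show "continuous_on {w \<in> X \<times> sphere 0 1. Im (snd w) \<le> 0} (\<lambda>w. H (fst w, 1 - arccos (Re (snd w)) / (2 * pi)))"
    proof (rule continuous_on_compose2[OF Hc])
      show "continuous_on {w \<in> X \<times> sphere 0 1. Im (snd w) \<le> 0} (\<lambda>w. (fst w, 1 - arccos (Re (snd w)) / (2 * pi)))"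
        by (intro continuous_on_Pair continuous_on_diff continuous_on_subset[OF cac] continuous_intros) auto
      show "(\<lambda>w. (fst w, 1 - arccos (Re (snd w)) / (2 * pi))) ` {w \<in> X \<times> sphere 0 1. Im (snd w) \<le> 0} \<subseteq> X \<times> {0..1}"
        using ac by auto
    qed
  next
    \<comment> \<open>The closed half circles meet in two points. At \<open>-1\<close> both
      parameters are \<open>1/2\<close>; at \<open>1\<close> they are 1 and 0, where the cyclic
      \<open>H\<close> takes the same value.\<close>
    fix w :: "'a \<times> complex" assume w: "w \<in> X \<times> sphere 0 1" "Im (snd w) = 0"
    then have "Re (snd w) = 1 \<or> Re (snd w) = -1" by (auto simp: cmod_def)
    then show "H (fst w, 1 - arccos (Re (snd w)) / (2 * pi)) = H (fst w, arccos (Re (snd w)) / (2 * pi))"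
      using H01 w by auto
  qed (auto intro!: continuous_intros)
  show "F \<in> X \<times> sphere 0 1 \<rightarrow> Y"
    using HY ac by (auto simp: F_def circle_parameter_def)
  show F1: "F (x, 1) = f x" if "x \<in> X" for x
    using H01 that by (simp add: F_def circle_parameter_def)
  show "F (x, cis (2 * pi * t)) = H (x, t)" if "x \<in> X" "t \<in> {0..1}" for x t
  proof (cases "t = 0")
    case True then show ?thesis using F1 H01 that by simp
  next
    case False then show ?thesis using circle_parameter_cis[of t] that by (simp add: F_def)
  qed
qed

text \<open>On the wedge the map obtained on the product with the circle equals
  \<open>wedge_map f a\<close> exactly, so the homotopy that is asked for can be constant.\<close>

lemma cyclic_homotopy_imp_gottlieb:
  assumes H: "cyclic_homotopy X Y f H" and x0: "x0 \<in> X"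
  shows "loop_class Y (\<lambda>t. H (x0, t)) \<in> gottlieb_group X Y f x0"
proof -
  obtain F where F: "continuous_on (X \<times> sphere 0 1) F" "F \<in> X \<times> sphere 0 1 \<rightarrow> Y"
    "\<And>x t. x \<in> X \<Longrightarrow> t \<in> {0..1} \<Longrightarrow> F (x, cis (2 * pi * t)) = H (x, t)"
    "\<And>x. x \<in> X \<Longrightarrow> F (x, 1) = f x"
    using cyclic_homotopy_on_circle[OF H] by blast
  define a where "a = (\<lambda>z. F (x0, z))"
  have "continuous_on (sphere 0 1) a"
    unfolding a_def by (rule continuous_on_compose2[OF F(1)]) (use x0 in \<open>auto intro!: continuous_intros\<close>)
  moreover have "a \<in> sphere 0 1 \<rightarrow> Y" "a 1 = f x0"
    using F(2,4) x0 by (auto simp: a_def)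
  moreover have "loop_class Y (\<lambda>t. H (x0, t)) = loop_class Y (\<lambda>t. a (cis (2 * pi * t)))"
    using cyclic_homotopy_loop[OF H x0] F(3)[OF x0]
    by (intro loop_class_eq homotopic_paths_eq) (auto simp: loops_def a_def)
  moreover have "homotopic_with_canon (\<lambda>_. True) (wedge_circle X x0) Y F (wedge_map f a)"
  proof (rule homotopic_with_equal)
    have sub: "wedge_circle X x0 \<subseteq> X \<times> sphere 0 1" using x0 by (auto simp: wedge_circle_def)
    show "continuous_map (top_of_set (wedge_circle X x0)) (top_of_set Y) F"
      using continuous_on_subset[OF F(1) sub] F(2) sub by (auto simp: continuous_map_in_subtopology)
    show "F w = wedge_map f a w" if "w \<in> topspace (top_of_set (wedge_circle X x0))" for w
      using that F(4) x0 by (auto simp: wedge_circle_def wedge_map_def a_def)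
  qed auto
  moreover have "loop_class Y (\<lambda>t. H (x0, t)) \<in> carrier (fundamental_group Y (f x0))"
    using cyclic_homotopy_loop[OF H x0] by (simp add: carrier_fundamental_group)
  ultimately show ?thesis
    using F(1,2) unfolding gottlieb_group_def by blast
qed

text \<open>The homotopy from \<open>F\<close> to \<open>f \<or> a\<close> need not fix \<open>X \<times> {1}\<close>, so \<open>F\<close> is conjugated by the
  restriction of that homotopy to \<open>X \<times> {1}\<close>. Its restriction to the circle at \<open>x\<^sub>0\<close> shows that the
  class of the loop is unchanged.\<close>

lemma gottlieb_imp_cyclic_homotopy:
  assumes c: "c \<in> gottlieb_group X Y f x0" and x0: "x0 \<in> X"
  obtains H where "cyclic_homotopy X Y f H" "c = loop_class Y (\<lambda>t. H (x0, t))"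
proof -
  obtain a F where a: "a 1 = f x0" "c = loop_class Y (\<lambda>t. a (cis (2 * pi * t)))"
    and F: "continuous_on (X \<times> sphere 0 1) F" "F \<in> X \<times> sphere 0 1 \<rightarrow> Y"
    and hom: "homotopic_with_canon (\<lambda>_. True) (wedge_circle X x0) Y F (wedge_map f a)"
    using c unfolding gottlieb_group_def by blast
  let ?W = "wedge_circle X x0"
  obtain k where k: "continuous_on ({0..1::real} \<times> ?W) k" "k \<in> {0..1} \<times> ?W \<rightarrow> Y"
    and k0: "\<And>w. k (0, w) = F w" and k1: "\<And>w. k (1, w) = wedge_map f a w"
    using hom unfolding homotopic_with_def by (auto simp: continuous_map_in_subtopology image_subset_iff)
  have W1: "(x, 1) \<in> ?W" if "x \<in> X" for x using that by (simp add: wedge_circle_def)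
  have Wc: "(x0, cis s) \<in> ?W" for s by (simp add: wedge_circle_def)
  \<comment> \<open>\<open>K\<close> leads from \<open>F (x, 1)\<close> to \<open>f x\<close> and
    \<open>K'\<close> back, so conjugating the turn \<open>L\<close> round the circle gives a
    homotopy from \<open>f\<close> to itself.\<close>
  define K where "K = (\<lambda>w. k (snd w, (fst w, 1)))"
  define K' where "K' = (\<lambda>w. k (1 - snd w, (fst w, 1)))"
  define L where "L = (\<lambda>w. F (fst w, cis (2 * pi * snd w)))"
  have Kc: "continuous_on (X \<times> {0..1}) K" "continuous_on (X \<times> {0..1}) K'"
    unfolding K_def K'_def
    by (rule continuous_on_compose2[OF k(1)], use W1 in \<open>auto intro!: continuous_intros\<close>)+
  have Lc: "continuous_on (X \<times> {0..1}) L"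
    unfolding L_def by (rule continuous_on_compose2[OF F(1)])
      (auto intro!: continuous_intros simp: cis_conv_exp)
  define LK where "LK = (\<lambda>w. ((\<lambda>s. L (fst w, s)) +++ (\<lambda>s. K (fst w, s))) (snd w))"
  define H where "H = (\<lambda>w. ((\<lambda>s. K' (fst w, s)) +++ (\<lambda>s. LK (fst w, s))) (snd w))"
  have LKc: "continuous_on (X \<times> {0..1}) LK"
    unfolding LK_def by (rule continuous_on_parametrized_join[OF Lc Kc(1)])
      (simp add: L_def K_def k0)
  have Hc: "continuous_on (X \<times> {0..1}) H"
    unfolding H_def by (rule continuous_on_parametrized_join[OF Kc(2) LKc])
      (simp add: LK_def L_def K'_def k0 joinpaths_def)
  have KY: "K w \<in> Y" "K' w \<in> Y" "L w \<in> Y" if "w \<in> X \<times> {0..1}" for w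
    using that k(2) F(2) W1 by (auto simp: K_def K'_def L_def)
  have LKY: "LK w \<in> Y" if "w \<in> X \<times> {0..1}" for w
    using that by (auto simp: LK_def joinpaths_def intro!: KY)
  have HY: "H w \<in> Y" if "w \<in> X \<times> {0..1}" for w
    using that by (auto simp: H_def joinpaths_def intro!: KY LKY)
  have "cyclic_homotopy X Y f H"
    unfolding cyclic_homotopy_def
    using Hc HY by (auto simp: H_def LK_def K_def K'_def joinpaths_def k1 wedge_map_def)
  moreover have "homotopic_paths Y (\<lambda>t. a (cis (2 * pi * t))) (\<lambda>t. H (x0, t))"
  proof -
    let ?Q = "{0..1::real} \<times> {0..1::real}"
    define u where "u = (\<lambda>w. k (fst w, (x0, cis (2 * pi * snd w))))"
    have uc: "continuous_on ?Q u"
      unfolding u_def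
    proof (rule continuous_on_compose2[OF k(1)])
      show "continuous_on ?Q (\<lambda>w. (fst w, x0, cis (2 * pi * snd w)))"
        unfolding cis_conv_exp by (intro continuous_intros)
    qed (use Wc in auto)
    have uY: "u \<in> ?Q \<rightarrow> Y" using k(2) Wc by (auto simp: u_def)
    have Q: "convex ?Q" by (intro convex_Times) auto
    have seg: "path_image (linepath v w) \<subseteq> ?Q" if "v \<in> ?Q" "w \<in> ?Q" for v w
      using that Q by (simp add: closed_segment_subset)
    \<comment> \<open>On the side \<open>?g\<close> the map \<open>u\<close> is the loop of
      \<open>a\<close>; on the other three sides it is the conjugated loop. The joins in
      \<open>?h\<close> are nested as in \<open>H\<close>, so the parametrizations match
      exactly.\<close>
    let ?g = "linepath (1,0) (1,1) :: real \<Rightarrow> real \<times> real"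
    let ?h = "linepath (1,0) (0,0) +++ (linepath (0,0) (0,1) +++ linepath (0,1) (1,1)) :: real \<Rightarrow> real \<times> real"
    have im: "path_image ?g \<subseteq> ?Q" "path_image ?h \<subseteq> ?Q"
      by (intro subset_path_image_join seg; simp)+
    have "homotopic_paths Y (u \<circ> ?g) (u \<circ> ?h)"
      by (rule homotopic_paths_convex_image[OF Q uc uY _ _ im]) simp_all
    moreover have "u \<circ> ?g = (\<lambda>t. a (cis (2 * pi * t)))"
      by (auto simp: u_def linepath_def k1 wedge_map_def a fun_eq_iff)
    moreover have "u \<circ> ?h = (\<lambda>t. H (x0, t))"
      by (auto simp: u_def linepath_def H_def LK_def L_def K_def K'_def joinpaths_def fun_eq_iff k0)
    ultimately show ?thesis by simp
  qed
  then have "c = loop_class Y (\<lambda>t. H (x0, t))" using a(2) loop_class_eq by simp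
  ultimately show ?thesis by (rule that)
qed

subsection \<open>Fibre-preserving homotopies\<close>

text \<open>A covering has continuous local sections, and through such a section \<open>H\<close> is
  locally a composition with \<open>G\<close>.\<close>

lemma continuous_on_covering_descent:
  assumes cov: "covering_space D p X" and G: "continuous_on (D \<times> {0..1::real}) G"
    and H: "\<And>x t. \<lbrakk>x \<in> D; t \<in> {0..1}\<rbrakk> \<Longrightarrow> H (p x, t) = G (x, t)"
  shows "continuous_on (X \<times> {0..1}) H"
proof -
  define sec where "sec y W k \<longleftrightarrow> y \<in> W \<and> openin (top_of_set X) W \<and> continuous_on W k \<and>
      k \<in> W \<rightarrow> D \<and> (\<forall>y'\<in>W. p (k y') = y')" for y W k
  have "\<exists>W k. sec y W k" if y: "y \<in> X" for y
  proof -
    obtain x T W k where *: "openin (top_of_set D) T" "y \<in> W" "openin (top_of_set X) W" "homeomorphism T W p k"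
      by (rule covering_space_local_homeomorphism_alt[OF cov y])
    moreover have "T \<subseteq> D" by (rule openin_imp_subset[OF *(1)])
    ultimately have "sec y W k" by (auto simp: sec_def homeomorphism_def)
    then show ?thesis by blast
  qed
  then obtain W k where "\<And>y. y \<in> X \<Longrightarrow> sec y (W y) (k y)" by metis
  then have W: "\<And>y. y \<in> X \<Longrightarrow> y \<in> W y" "\<And>y. y \<in> X \<Longrightarrow> openin (top_of_set X) (W y)"
    and k: "\<And>y. y \<in> X \<Longrightarrow> continuous_on (W y) (k y)" "\<And>y. y \<in> X \<Longrightarrow> k y \<in> W y \<rightarrow> D"
      "\<And>y y'. \<lbrakk>y \<in> X; y' \<in> W y\<rbrakk> \<Longrightarrow> p (k y y') = y'"
    unfolding sec_def by blast+
  have "continuous_map (top_of_set (X \<times> {0..1})) euclidean H"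
  \<comment> \<open>Every piece is \<open>H\<close> itself: the pasting lemma only passes from local
    to global continuity.\<close>
  proof (rule pasting_lemma[where I = X and T = "\<lambda>i. W i \<times> {0..1}" and f = "\<lambda>_. H"])
    fix i assume i: "i \<in> X"
    show "openin (top_of_set (X \<times> {0..1::real})) (W i \<times> {0..1})"
      using W(2)[OF i] by (simp add: openin_Times)
    have "continuous_on (W i \<times> {0..1::real}) (\<lambda>w. G (k i (fst w), snd w))"
      by (rule continuous_on_compose2[OF G])
        (use k(2)[OF i] in \<open>auto intro!: continuous_intros continuous_on_compose2[OF k(1)[OF i]]\<close>)
    moreover have "H w = G (k i (fst w), snd w)" if "w \<in> W i \<times> {0..1}" for w
    proof -
      have w: "fst w \<in> W i" "snd w \<in> {0..1}" using that by auto
      then have "k i (fst w) \<in> D" using k(2)[OF i] by auto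
      then show ?thesis using H[of "k i (fst w)" "snd w"] k(3)[OF i w(1)] w by simp
    qed
    ultimately have "continuous_on (W i \<times> {0..1}) H"
      using continuous_on_cong[of "W i \<times> {0..1}" "W i \<times> {0..1}" H "\<lambda>w. G (k i (fst w), snd w)"] by simp
    moreover have "W i \<subseteq> X" by (rule openin_imp_subset[OF W(2)[OF i]])
    ultimately show "continuous_map (subtopology (top_of_set (X \<times> {0..1})) (W i \<times> {0..1})) euclidean H"
      by (simp add: subtopology_subtopology Int_absorb1 Times_Int_Times)
  next
    fix w assume "w \<in> topspace (top_of_set (X \<times> {0..1::real}))"
    then show "\<exists>j. j \<in> X \<and> w \<in> W j \<times> {0..1} \<and> H w = H w"
      using W(1) by (intro exI[of _ "fst w"]) auto
  qed simp
  then show ?thesis by simp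
qed

lemma deck_gottliebE:
  assumes "h \<in> deck_gottlieb D p E q g"
  obtains H where "h \<in> deck_transformations E q" "continuous_on (D \<times> {0..1::real}) H"
    "\<And>w. w \<in> D \<times> {0..1} \<Longrightarrow> H w \<in> E"
    "\<And>x x' t. \<lbrakk>x \<in> D; x' \<in> D; t \<in> {0..1}; p x = p x'\<rbrakk> \<Longrightarrow> q (H (x, t)) = q (H (x', t))"
    "\<And>x. x \<in> D \<Longrightarrow> H (x, 0) = g x" "\<And>x. x \<in> D \<Longrightarrow> H (x, 1) = h (g x)"
proof -
  from assms obtain H where "fibre_preserving_homotopy D p E q H" "h \<in> deck_transformations E q"
    "\<forall>x\<in>D. H (x, 0) = g x" "\<forall>x\<in>D. H (x, 1) = h (g x)"
    unfolding deck_gottlieb_def by blast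
  then show ?thesis
    unfolding fibre_preserving_homotopy_def by (intro that[of H]) blast+
qed

text \<open>The inverse of \<open>h\<close> is realised by the reversed homotopy followed by the
  inverse of \<open>h\<close>, a product by \<open>H\<close> continued with the translate of
  \<open>H'\<close> by \<open>h\<close>. Fibres are still preserved because deck transformations
  leave \<open>q\<close> unchanged.\<close>

lemma deck_gottlieb_subgroup:
  assumes g: "lifting_of D p E q f g"
  shows "subgroup (deck_gottlieb D p E q g) (deck_group E q)"
proof (rule group.subgroupI[OF group_deck_group])
  have gc: "continuous_on D g" "\<And>x. x \<in> D \<Longrightarrow> g x \<in> E" "\<And>x. x \<in> D \<Longrightarrow> q (g x) = f (p x)"
    using g by (auto simp: lifting_of_def)
  show "deck_gottlieb D p E q g \<subseteq> carrier (deck_group E q)" by (auto simp: deck_gottlieb_def)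
  have "continuous_on (D \<times> {0..1::real}) (\<lambda>w. g (fst w))"
    by (rule continuous_on_compose2[OF gc(1)]) (auto intro!: continuous_intros)
  then have "fibre_preserving_homotopy D p E q (\<lambda>w. g (fst w))"
    using gc by (auto simp: fibre_preserving_homotopy_def)
  then have "(\<lambda>x\<in>E. x) \<in> deck_gottlieb D p E q g"
    using gc deck_transformation_id[of E q] unfolding deck_gottlieb_def
    by (auto intro!: exI[of _ "\<lambda>w. g (fst w)"])
  then show "deck_gottlieb D p E q g \<noteq> {}" by blast
next
  fix h assume h: "h \<in> deck_gottlieb D p E q g"
  let ?k = "restrict (inv_into E h) E"
  obtain H where hd: "h \<in> deck_transformations E q"
    and H: "continuous_on (D \<times> {0..1::real}) H" "\<And>w. w \<in> D \<times> {0..1} \<Longrightarrow> H w \<in> E"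
      "\<And>x x' t. \<lbrakk>x \<in> D; x' \<in> D; t \<in> {0..1}; p x = p x'\<rbrakk> \<Longrightarrow> q (H (x, t)) = q (H (x', t))"
      "\<And>x. x \<in> D \<Longrightarrow> H (x, 0) = g x" "\<And>x. x \<in> D \<Longrightarrow> H (x, 1) = h (g x)"
    using h by (rule deck_gottliebE) blast
  have gE: "\<And>x. x \<in> D \<Longrightarrow> g x \<in> E" using g by (auto simp: lifting_of_def)
  note k = deck_transformation_inverse[OF hd]
  note kD = deck_transformationD[OF k(1)]
  let ?G = "\<lambda>w. ?k (H (fst w, 1 - snd w))"
  have "continuous_on (D \<times> {0..1}) (\<lambda>w. H (fst w, 1 - snd w))"
    by (rule continuous_on_compose2[OF H(1)]) (auto intro!: continuous_intros)
  then have "continuous_on (D \<times> {0..1}) ?G"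
    by (rule continuous_on_compose2[OF kD(1)]) (auto intro!: H(2))
  moreover have "?G \<in> D \<times> {0..1} \<rightarrow> E" by (intro Pi_I kD(3) H(2)) auto
  moreover have "q (?G (x, t)) = q (?G (x', t))" if "x \<in> D" "x' \<in> D" "t \<in> {0..1}" "p x = p x'" for x x' t
  proof -
    have "q (?G (x, t)) = q (H (x, 1 - t))" "q (?G (x', t)) = q (H (x', 1 - t))"
      using that kD(4)[OF H(2)[of "(x, 1 - t)"]] kD(4)[OF H(2)[of "(x', 1 - t)"]] by auto
    then show ?thesis using that H(3)[of x x' "1 - t"] by simp
  qed
  ultimately have "fibre_preserving_homotopy D p E q ?G"
    unfolding fibre_preserving_homotopy_def by blast
  moreover have "?G (x, 0) = g x" "?G (x, 1) = ?k (g x)" if "x \<in> D" for x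
    using that H(4,5) k(2) gE deck_transformationD(3)[OF hd] by auto
  ultimately have "?k \<in> deck_gottlieb D p E q g"
    using k(1) unfolding deck_gottlieb_def by blast
  then show "inv\<^bsub>deck_group E q\<^esub> h \<in> deck_gottlieb D p E q g" by (simp add: inv_deck_group[OF hd])
next
  fix h h' assume h: "h \<in> deck_gottlieb D p E q g" and h': "h' \<in> deck_gottlieb D p E q g"
  obtain H where hd: "h \<in> deck_transformations E q"
    and H: "continuous_on (D \<times> {0..1::real}) H" "\<And>w. w \<in> D \<times> {0..1} \<Longrightarrow> H w \<in> E"
      "\<And>x x' t. \<lbrakk>x \<in> D; x' \<in> D; t \<in> {0..1}; p x = p x'\<rbrakk> \<Longrightarrow> q (H (x, t)) = q (H (x', t))"
      "\<And>x. x \<in> D \<Longrightarrow> H (x, 0) = g x" "\<And>x. x \<in> D \<Longrightarrow> H (x, 1) = h (g x)"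
    using h by (rule deck_gottliebE) blast
  obtain H' where hd': "h' \<in> deck_transformations E q"
    and H': "continuous_on (D \<times> {0..1::real}) H'" "\<And>w. w \<in> D \<times> {0..1} \<Longrightarrow> H' w \<in> E"
      "\<And>x x' t. \<lbrakk>x \<in> D; x' \<in> D; t \<in> {0..1}; p x = p x'\<rbrakk> \<Longrightarrow> q (H' (x, t)) = q (H' (x', t))"
      "\<And>x. x \<in> D \<Longrightarrow> H' (x, 0) = g x" "\<And>x. x \<in> D \<Longrightarrow> H' (x, 1) = h' (g x)"
    using h' by (rule deck_gottliebE) blast
  have gE: "\<And>x. x \<in> D \<Longrightarrow> g x \<in> E" using g by (auto simp: lifting_of_def)
  note hD = deck_transformationD[OF hd]
  define G where "G = (\<lambda>w. ((\<lambda>s. H (fst w, s)) +++ (\<lambda>s. h (H' (fst w, s)))) (snd w))"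
  have "continuous_on (D \<times> {0..1}) (\<lambda>w. h (H' w))"
    by (rule continuous_on_compose2[OF hD(1) H'(1)]) (auto intro!: H'(2))
  then have "continuous_on (D \<times> {0..1}) G"
    unfolding G_def by (intro continuous_on_parametrized_join[OF H(1)]) (auto simp: H(5) H'(4))
  moreover have "G \<in> D \<times> {0..1} \<rightarrow> E"
    by (auto simp: G_def joinpaths_def intro!: H(2) H'(2) hD(3))
  moreover have "q (G (x, t)) = q (G (x', t))" if *: "x \<in> D" "x' \<in> D" "t \<in> {0..1}" "p x = p x'" for x x' t
  proof (cases "t \<le> 1/2")
    case True then show ?thesis using * H(3)[of x x' "2 * t"] by (simp add: G_def joinpaths_def)
  next
    case False
    then have "q (h (H' (x, 2 * t - 1))) = q (H' (x, 2 * t - 1))" "q (h (H' (x', 2 * t - 1))) = q (H' (x', 2 * t - 1))"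
      using * by (auto intro!: hD(4) H'(2))
    then show ?thesis using False * H'(3)[of x x' "2 * t - 1"] by (simp add: G_def joinpaths_def)
  qed
  ultimately have "fibre_preserving_homotopy D p E q G"
    unfolding fibre_preserving_homotopy_def by blast
  moreover have "G (x, 0) = g x" "G (x, 1) = compose E h h' (g x)" if "x \<in> D" for x
    using that H(4) H'(5) gE by (auto simp: G_def joinpaths_def compose_def)
  ultimately have "compose E h h' \<in> deck_gottlieb D p E q g"
    using deck_transformation_compose[OF hd hd'] unfolding deck_gottlieb_def by blast
  then show "h \<otimes>\<^bsub>deck_group E q\<^esub> h' \<in> deck_gottlieb D p E q g" by (simp add: mult_deck_group[OF hd hd'])
qed

section \<open>Comparison of the two subgroups\<close>

lemma canonical_map_gottlieb_image:
  assumes ucX: "universal_covering D p X" and ucY: "universal_covering E q Y"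
    and g: "lifting_of D p E q f g" and x: "x \<in> D"
  shows "canonical_map E q (g x) ` gottlieb_group X Y f (p x) = deck_gottlieb D p E q g"
proof -
  have covX: "covering_space D p X" and covY: "covering_space E q Y"
    and D: "connected D"
    using ucX ucY simply_connected_imp_connected_space by (auto simp: universal_covering_def)
  have pc: "continuous_on D p" "p ` D = X" using covX by (auto simp: covering_space_def)
  have qc: "continuous_on E q" "q ` E = Y" using covY by (auto simp: covering_space_def)
  have gc: "continuous_on D g" "g \<in> D \<rightarrow> E" "\<And>x. x \<in> D \<Longrightarrow> q (g x) = f (p x)"
    using g by (auto simp: lifting_of_def)
  let ?T = "canonical_map E q (g x)"
  have gx: "g x \<in> E" "q (g x) = f (p x)" and px: "p x \<in> X" using gc x pc by auto
  show ?thesis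
  proof (intro equalityI subsetI)
    fix h assume "h \<in> ?T ` gottlieb_group X Y f (p x)"
    then obtain c where c: "c \<in> gottlieb_group X Y f (p x)" "h = ?T c" by blast
    obtain H where H: "cyclic_homotopy X Y f H" and cH: "c = loop_class Y (\<lambda>t. H (p x, t))"
      by (rule gottlieb_imp_cyclic_homotopy[OF c(1) px])
    have Hc: "continuous_on (X \<times> {0..1}) H" "H \<in> X \<times> {0..1} \<rightarrow> Y"
        "\<And>y. y \<in> X \<Longrightarrow> H (y, 0) = f y" "\<And>y. y \<in> X \<Longrightarrow> H (y, 1) = f y"
      using H by (auto simp: cyclic_homotopy_def)
    have "continuous_on (D \<times> {0..1}) (\<lambda>w. H (p (fst w), snd w))"
      by (rule continuous_on_compose2[OF Hc(1)])
        (use pc in \<open>auto intro!: continuous_intros continuous_on_compose2[OF pc(1)]\<close>)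
    moreover have "(\<lambda>w. H (p (fst w), snd w)) \<in> D \<times> {0..1} \<rightarrow> Y" using Hc(2) pc by auto
    moreover have "q (g z) = H (p (fst (z, 0::real)), snd (z, 0))" if "z \<in> D" for z
      using gc(3) Hc(3) pc that by auto
    ultimately obtain K where K: "continuous_on (D \<times> {0..1::real}) K" "K \<in> D \<times> {0..1} \<rightarrow> E"
        "\<And>z. z \<in> D \<Longrightarrow> K (z, 0) = g z" "\<And>w. w \<in> D \<times> {0..1} \<Longrightarrow> q (K w) = H (p (fst w), snd w)"
      using covering_homotopy_lift[OF covY _ _ gc(1,2), of "\<lambda>w. H (p (fst w), snd w)"] by blast
    \<comment> \<open>The composite of \<open>q\<close> and \<open>K\<close> factors through
      \<open>p\<close>, because the lifted homotopy was a pullback along \<open>p\<close>.\<close>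
    have fib: "fibre_preserving_homotopy D p E q K"
      using K(1,2,4) by (auto simp: fibre_preserving_homotopy_def)
    have "continuous_on {0..1} (\<lambda>t. K (x, t))"
      by (rule continuous_on_compose2[OF K(1)]) (use x in \<open>auto intro!: continuous_intros\<close>)
    \<comment> \<open>The track of \<open>x\<close> under \<open>K\<close> lifts the loop, so its
      end point determines \<open>h\<close>.\<close>
    then have lift: "path_lift E q (g x) (\<lambda>t. H (p x, t)) (\<lambda>t. K (x, t))"
      using K x by (intro path_liftI) auto
    have loop: "(\<lambda>t. H (p x, t)) \<in> loops Y (q (g x))"
      using cyclic_homotopy_loop[OF H px] gx by simp
    have h: "h \<in> deck_transformations E q" "h (g x) = K (x, 1)"
      using canonical_map_lift[OF ucY gx(1) loop lift] c(2) cH by (auto simp: pathfinish_def)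
    note hD = deck_transformationD[OF h(1)]
    have "K (z, 1) = h (g z)" if "z \<in> D" for z
    proof (rule covering_lift_unique[OF covY, of D "\<lambda>z. K (z, 1)" "\<lambda>z. h (g z)" x])
      show "continuous_on D (\<lambda>z. K (z, 1))"
        by (rule continuous_on_compose2[OF K(1)]) (auto intro!: continuous_intros)
      show "continuous_on D (\<lambda>z. h (g z))"
        by (rule continuous_on_compose2[OF hD(1) gc(1)]) (use gc in auto)
      show "q (K (z, 1)) = q (h (g z))" if "z \<in> D" for z
      proof -
        have "g z \<in> E" "p z \<in> X" using that gc(2) pc(2) by auto
        then show ?thesis using that K(4)[of "(z, 1)"] hD(4) gc(3) Hc(4) by simp
      qed
    qed (use K(2) gc(2) hD(3) D x that h(2) in auto)
    then show "h \<in> deck_gottlieb D p E q g"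
      using fib h(1) K(3) unfolding deck_gottlieb_def by blast
  next
    fix h assume "h \<in> deck_gottlieb D p E q g"
    then obtain K where h: "h \<in> deck_transformations E q"
      and K: "continuous_on (D \<times> {0..1::real}) K" "\<And>w. w \<in> D \<times> {0..1} \<Longrightarrow> K w \<in> E"
        "\<And>x x' t. \<lbrakk>x \<in> D; x' \<in> D; t \<in> {0..1}; p x = p x'\<rbrakk> \<Longrightarrow> q (K (x, t)) = q (K (x', t))"
        "\<And>x. x \<in> D \<Longrightarrow> K (x, 0) = g x" "\<And>x. x \<in> D \<Longrightarrow> K (x, 1) = h (g x)"
      by (rule deck_gottliebE) blast
    \<comment> \<open>\<open>s\<close> is a mere set-theoretic section. Fibre preservation makes
      \<open>H\<close> independent of its choice, and continuity is recovered from local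
      sections.\<close>
    define s where "s = inv_into D p"
    have s: "s y \<in> D" "p (s y) = y" if "y \<in> X" for y
      using that pc(2) by (auto simp: s_def inv_into_into f_inv_into_f)
    define H where "H = (\<lambda>w. q (K (s (fst w), snd w)))"
    have HK: "H (p z, t) = q (K (z, t))" if "z \<in> D" "t \<in> {0..1}" for z t
      using s[of "p z"] pc(2) that K(3)[of "s (p z)" z t] by (auto simp: H_def)
    have "continuous_on (D \<times> {0..1}) (\<lambda>w. q (K w))"
      by (rule continuous_on_compose2[OF qc(1) K(1)]) (use K(2) in auto)
    then have "continuous_on (X \<times> {0..1}) H"
      by (rule continuous_on_covering_descent[OF covX]) (rule HK)
    moreover have "H \<in> X \<times> {0..1} \<rightarrow> Y"
      using s K(2) qc(2) by (auto simp: H_def)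
    \<comment> \<open>At time 1 the deck transformation disappears under \<open>q\<close>, so the
      homotopy closes up.\<close>
    moreover have "H (y, 0) = f y" "H (y, 1) = f y" if "y \<in> X" for y
    proof -
      have "g (s y) \<in> E" using gc(2) s(1)[OF that] by blast
      then show "H (y, 0) = f y" "H (y, 1) = f y"
        using s[OF that] K(4,5) gc(3) deck_transformationD(4)[OF h] by (simp_all add: H_def)
    qed
    ultimately have H: "cyclic_homotopy X Y f H" by (simp add: cyclic_homotopy_def)
    have "continuous_on {0..1} (\<lambda>t. K (x, t))"
      by (rule continuous_on_compose2[OF K(1)]) (use x in \<open>auto intro!: continuous_intros\<close>)
    then have lift: "path_lift E q (g x) (\<lambda>t. H (p x, t)) (\<lambda>t. K (x, t))"
      using K(2,4) x HK by (intro path_liftI) auto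
    have loop: "(\<lambda>t. H (p x, t)) \<in> loops Y (q (g x))"
      using cyclic_homotopy_loop[OF H px] gx by simp
    have "?T (loop_class Y (\<lambda>t. H (p x, t))) = h"
      using canonical_map_lift[OF ucY gx(1) loop lift] K(5)[OF x]
      by (intro deck_transformation_eqI[OF ucY gx(1) _ h]) (auto simp: pathfinish_def)
    then show "h \<in> ?T ` gottlieb_group X Y f (p x)"
      using cyclic_homotopy_imp_gottlieb[OF H px] by blast
  qed
qed

text \<open>Through this the Gottlieb group inherits its subgroup property from the deck side, and
  no homotopies over the circle have to be multiplied or inverted.\<close>

lemma subgroup_hom_preimage:
  assumes "group G" "group H" "h \<in> hom G H" "subgroup K H"
  shows "subgroup {x \<in> carrier G. h x \<in> K} G"
proof -
  interpret group_hom G H h using assms by (simp add: group_hom_def group_hom_axioms_def)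
  show ?thesis
    using subgroup.one_closed[OF assms(4)] subgroup.m_closed[OF assms(4)] subgroup.m_inv_closed[OF assms(4)]
    by (intro G.subgroupI) (auto intro!: exI[of _ "\<one>\<^bsub>G\<^esub>"])
qed

theorem theorem2p1:
  fixes X :: "'x::topological_space set" and Y :: "'y::topological_space set"
    and X' :: "'d::topological_space set" and Y' :: "'e::topological_space set"
    and p :: "'d \<Rightarrow> 'x" and q :: "'e \<Rightarrow> 'y"
    and K :: "'k topology" and L :: "'l topology"
    and f :: "'x \<Rightarrow> 'y" and f0 :: "'d \<Rightarrow> 'e" and x0 :: 'x and x0' :: 'd
  assumes "path_connected X" and "CW_complex K" and "top_of_set X homotopy_equivalent_space K"
    and "path_connected Y" and "CW_complex L" and "top_of_set Y homotopy_equivalent_space L"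
    and "universal_covering X' p X" and "universal_covering Y' q Y"
    and "continuous_on X f" and "f \<in> X \<rightarrow> Y"
    and "lifting_of X' p Y' q f f0"
    and "x0 \<in> X" and "x0' \<in> X'" and "p x0' = x0"
  defines "\<pi> \<equiv> fundamental_group Y (f x0)" and "\<D> \<equiv> deck_group Y' q"
    and "G \<equiv> gottlieb_group X Y f x0" and "\<D>f \<equiv> deck_gottlieb X' p Y' q f0"
    and "\<Theta> \<equiv> canonical_map Y' q (f0 x0')"
  shows "\<Theta> \<in> iso \<pi> \<D> \<and> subgroup G \<pi> \<and> subgroup \<D>f \<D> \<and>
         \<Theta> ` G = \<D>f \<and> \<Theta> \<in> iso (\<pi>\<lparr>carrier := G\<rparr>) (\<D>\<lparr>carrier := \<D>f\<rparr>)"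
proof -
  have e: "f0 x0' \<in> Y'" "q (f0 x0') = f x0"
    using assms(11,13,14) by (auto simp: lifting_of_def)
  have iso: "\<Theta> \<in> iso \<pi> \<D>"
    using canonical_map_iso(1)[OF assms(8) e(1)] e(2) by (simp add: \<Theta>_def \<pi>_def \<D>_def)
  have group: "group \<pi>" "group \<D>"
    using group_fundamental_group[OF assms(8) e(1)] group_deck_group e(2) by (simp_all add: \<pi>_def \<D>_def)
  have img: "\<Theta> ` G = \<D>f"
    using canonical_map_gottlieb_image[OF assms(7,8,11,13)] assms(14)
    by (simp add: \<Theta>_def G_def \<D>f_def)
  have Df: "subgroup \<D>f \<D>"
    unfolding \<D>f_def \<D>_def by (rule deck_gottlieb_subgroup[OF assms(11)])
  have "G \<subseteq> carrier \<pi>" by (auto simp: G_def \<pi>_def gottlieb_group_def)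
  moreover have inj: "inj_on \<Theta> (carrier \<pi>)" and hom: "\<Theta> \<in> hom \<pi> \<D>"
    using iso by (auto simp: iso_def bij_betw_def)
  \<comment> \<open>Injectivity on the whole fundamental group turns the image equation into one
    about preimages: no class outside \<open>G\<close> is sent into \<open>\<D>f\<close>.\<close>
  ultimately have "G = {c \<in> carrier \<pi>. \<Theta> c \<in> \<D>f}"
    using img by (auto simp: inj_on_def)
  then have G: "subgroup G \<pi>"
    using subgroup_hom_preimage[OF group hom Df] by simp
  have "\<Theta> \<in> iso (\<pi>\<lparr>carrier := G\<rparr>) (\<D>\<lparr>carrier := \<D>f\<rparr>)"
    using hom inj img \<open>G \<subseteq> carrier \<pi>\<close>
    by (auto simp: iso_def hom_def bij_betw_def subset_iff intro: inj_on_subset)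
  with iso G Df img show ?thesis by blast
qed

end
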